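(* For $\lambda>0$ and $X\ge 1$ let \[N_{\lambda}(X)=\#\{(a,b,c)\in\mathbb{N}^3:\ a+b=c,\ c\le X,\ \gcd(a,b,c)=1,\ \operatorname{rad}(abc)<c^{\lambda}\},\] where $\operatorname{rad}(n)$ denotes the product of the distinct primes dividing $n$. Then for every $\lambda\in(0,2)$ and every $\varepsilon>0$ we have \[N_{\lambda}(X)\ll_{\lambda,\varepsilon} X^{\frac{23\lambda+3}{40}+\varepsilon}\] for all $X\ge 1$. In particular, $N_1(X)\ll_{\varepsilon} X^{0.65+\varepsilon}$ for every $\varepsilon>0$, and $N_{\lambda}(X)=o(X^{2\lambda/3})$ as $X\to\infty$ for every $\lambda\in(9/11,3)$.
   Context: $\mathbb{N}$ denotes the positive integers. The notation $f\ll_{\lambda,\varepsilon} g$ means $|f|\le C g$ for a constant $C$ depending only on $\lambda$ and $\varepsilon$. *)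

theory Defs
  imports
    Complex_Main
    "HOL-Computational_Algebra.Primes"
    "HOL-Library.Landau_Symbols"
begin

definition rad :: "nat \<Rightarrow> nat" where
  "rad n = \<Prod>(prime_factors n)"

(* The set counted is finite for every real X, since a, b < c \<le> X, so its card is the
   genuine number of triples. *)
definition abc_count :: "real \<Rightarrow> real \<Rightarrow> nat" where
  "abc_count lam X =
     card {(a::nat, b::nat, c::nat).
             0 < a \<and> 0 < b \<and> 0 < c \<and> a + b = c \<and> real c \<le> X \<and>
             gcd a (gcd b c) = 1 \<and> real (rad (a * b * c)) < real c powr lam}"

end

(* Write a, b and c as products of i-th powers of squarefree numbers x_i (i < 6) and a 6-full
   number, and sort the triples into boxes according to the sizes of all these factors on a
   logarithmic scale.  In a box, fix everything except for some factors of two of the numbers, which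
   are grouped to g-th powers x^g and y^g, and fix some factors of the third one, with product q.
   Then m x^g = +- n y^g modulo q confines (x, y) to X^o(1) lattices of
   determinant q, and coprime points of a box in such a lattice are separated by slope, so that
   there are O(1 + |box| / q) of them; if the third number is small, the points moreover lie in a
   thin cone.  After normalising the sizes, these bounds are symmetric in a, b and c.  That the best
   one is good enough is a statement about the exponents of the boxes, which follows from a chain of
   linear inequalities. *)
theory Submission
  imports Defs "HOL-Number_Theory.Number_Theory"
begin

section \<open>Numbers composed of few primes\<close>

text \<open>The benchmark is the exponent \<open>2 * lam / 3\<close>. Two of the three numbers
  determine the triple, so up to X^o(1) a box holds at most rad(a) rad(b) triples, and likewise for
  the other two pairs; the geometric mean of these trivial bounds is
  \<open>X powr (2 * lam / 3)\<close>. The line \<open>(23 * lam + 3) / 40\<close> meets the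
  benchmark at \<open>lam = 9 / 11\<close>: up to there the trivial bounds suffice, beyond it the
  lattice bounds must save something. For \<open>lam\<close> between 2 and 3 one lattice bound
  together with the trivial ones already beats the benchmark.

  Parts 1 to 5 are exact powers of their radicals, which is what lets them supply variables x^g. The
  6-full part has no such form, so it is only ever fixed or used in the modulus. Fixing factors is
  cheap because the integers up to Y with radical at most R number only R Y^o(1), whatever their
  sizes; hence boxes are described by radicals. All losses are powers of X whose exponent is a
  bounded multiple of the box width \<open>\<eta>\<close>, so the optimisation can work with exact
  exponents.\<close>

lemma power_card_primes_le:
  fixes K \<eta> :: real
  assumes "1 \<le> K" "0 < \<eta>"
  shows "\<exists>C\<ge>1. \<forall>P::nat set. finite P \<longrightarrow> (\<forall>p\<in>P. prime p) \<longrightarrow> K ^ card P \<le> C * real (\<Prod>P) powr \<eta>"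
proof -
  \<comment> \<open>Primes from \<open>N\<close> on pay for their own factor, as \<open>K\<close> is
    at most \<open>p powr \<eta>\<close>; fewer than \<open>N + 1\<close> primes are smaller, and
    they cost \<open>K ^ N\<close> in total.\<close>
  define N where "N = nat \<lceil>K powr (1/\<eta>)\<rceil>"
  have NK: "K \<le> real n powr \<eta>" if "N \<le> n" for n
  proof -
    have "K powr (1/\<eta>) \<le> real n"
      using that unfolding N_def by linarith
    then have "(K powr (1/\<eta>)) powr \<eta> \<le> real n powr \<eta>"
      using assms by (intro powr_mono2) auto
    then show ?thesis using assms by (simp add: powr_powr)
  qed
  have "K ^ card P \<le> K ^ N * real (\<Prod>P) powr \<eta>"
    if P: "finite P" "\<forall>p\<in>P. prime p" for P :: "nat set"
  proof -
    have "K ^ card P = (\<Prod>p\<in>P. K)" by simp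
    also have "\<dots> \<le> (\<Prod>p\<in>P. (if p < N then K else 1) * real p powr \<eta>)"
    proof (rule prod_mono)
      fix p assume "p \<in> P"
      then have "p \<ge> 1" using P prime_ge_1_nat by blast
      then have "1 \<le> real p powr \<eta>" using assms by (simp add: ge_one_powr_ge_zero)
      then show "0 \<le> K \<and> K \<le> (if p < N then K else 1) * real p powr \<eta>"
        using NK[of p] assms by (auto simp: mult_le_cancel_left1)
    qed
    also have "\<dots> = (\<Prod>p\<in>P. if p < N then K else 1) * (\<Prod>p\<in>P. real p powr \<eta>)"
      by (rule prod.distrib)
    also have "(\<Prod>p\<in>P. if p < N then K else 1) = K ^ card {p\<in>P. p < N}"
      using P by (simp add: prod.If_cases Int_def)
    also have "\<dots> * (\<Prod>p\<in>P. real p powr \<eta>) \<le> K ^ N * (\<Prod>p\<in>P. real p powr \<eta>)"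
    proof (intro mult_right_mono power_increasing prod_nonneg)
      have "card {p\<in>P. p < N} \<le> card {..<N}" by (intro card_mono) auto
      then show "card {p\<in>P. p < N} \<le> N" by simp
    qed (use assms in auto)
    also have "(\<Prod>p\<in>P. real p powr \<eta>) = real (\<Prod>P) powr \<eta>"
      by (simp add: prod_powr_distrib)
    finally show ?thesis .
  qed
  then show ?thesis using assms by (intro exI[of _ "K ^ N"]) auto
qed

lemma finite_bounded_nat: "finite {s::nat. real s \<le> Y \<and> Q s}"
proof (rule finite_subset)
  show "{s::nat. real s \<le> Y \<and> Q s} \<subseteq> {..nat \<lfloor>Y\<rfloor>}"
    by (auto simp: le_nat_floor)
qed auto

(* Rankin's trick, one prime at a time. *)
lemma card_smooth_le:
  fixes \<eta> Y :: real
  assumes "finite P" "\<forall>p\<in>P. prime p" "0 < \<eta>" "0 \<le> Y"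
  shows "real (card {s::nat. real s \<le> Y \<and> 0 < s \<and> prime_factors s \<subseteq> P})
           \<le> Y powr \<eta> * (1 / (1 - 2 powr - \<eta>)) ^ card P"
  using assms
proof (induction P arbitrary: Y rule: finite_induct)
  case empty
  have "{s::nat. real s \<le> Y \<and> 0 < s \<and> prime_factors s \<subseteq> {}} \<subseteq> (if 1 \<le> Y then {1} else {})"
    by (auto simp: prime_factorization_empty_iff)
  then have "card {s::nat. real s \<le> Y \<and> 0 < s \<and> prime_factors s \<subseteq> {}}
      \<le> card (if 1 \<le> Y then {1::nat} else {})" by (intro card_mono) auto
  also have "real \<dots> \<le> Y powr \<eta>" using empty by (auto simp: ge_one_powr_ge_zero)
  finally show ?case by simp
next
  case (insert p P)
  have p: "prime p" "2 \<le> p" using insert.prems prime_ge_2_nat by auto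
  define K where "K = 1 / (1 - 2 powr - \<eta>)"
  define S where "S = (\<lambda>P Y. {s::nat. real s \<le> Y \<and> 0 < s \<and> prime_factors s \<subseteq> P})"
  have finS: "finite (S P Y)" for P Y unfolding S_def by (rule finite_bounded_nat)
  \<comment> \<open>A crude cutoff for the exponent \<open>e\<close> of \<open>p\<close>: since
    \<open>e < p ^ e\<close> and \<open>p ^ e \<le> s \<le> Y\<close>, it is at most
    \<open>N\<close>, so a finite union over \<open>e\<close> suffices.\<close>
  define N where "N = nat \<lfloor>Y\<rfloor>"
  define t where "t = real p powr - \<eta>"
  have t2: "t \<le> 2 powr - \<eta>" unfolding t_def using p insert.prems by (intro powr_mono2') auto
  have t0: "0 \<le> t" unfolding t_def by simp
  have t1: "2 powr - \<eta> < 1" using insert.prems by (simp add: powr_less_one)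
  have K0: "0 \<le> K" unfolding K_def using t1 by simp
  have sub: "S (insert p P) Y \<subseteq> (\<Union>e\<in>{..N}. (*) (p ^ e) ` S P (Y / real (p ^ e)))"
  proof
    fix s assume s: "s \<in> S (insert p P) Y"
    define e where "e = multiplicity p s"
    have s0: "s \<noteq> 0" using s by (auto simp: S_def)
    define u where "u = s div p ^ e"
    have u: "s = p ^ e * u" "\<not> p dvd u"
    proof -
      show "s = p ^ e * u" unfolding u_def e_def by (simp add: multiplicity_dvd)
      have "\<not> is_unit p" using p by simp
      then show "\<not> p dvd u" unfolding u_def e_def using s0 by (intro multiplicity_decompose)
    qed
    have u0: "u \<noteq> 0" using u s0 by auto
    have "p ^ e \<le> s" using u s0 by (simp add: Suc_leI)
    moreover have "e < p ^ e" using p by (intro power_gt_expt) auto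
    moreover have "s \<le> N" using s unfolding S_def N_def by (auto simp: le_nat_floor)
    ultimately have "e \<le> N" by linarith
    moreover have "u \<in> S P (Y / real (p ^ e))"
    proof -
      have "prime_factors u \<subseteq> prime_factors s" using u s0 by (simp add: dvd_prime_factors)
      moreover have "p \<notin> prime_factors u" using u by auto
      moreover have "real u \<le> Y / real (p ^ e)"
        using s u p by (simp add: S_def field_simps)
      ultimately show ?thesis using s u0 by (auto simp: S_def)
    qed
    ultimately show "s \<in> (\<Union>e\<in>{..N}. (*) (p ^ e) ` S P (Y / real (p ^ e)))"
      using u by blast
  qed
  have "real (card (S (insert p P) Y)) \<le> real (card (\<Union>e\<in>{..N}. (*) (p ^ e) ` S P (Y / real (p ^ e))))"
    using sub finS by (intro of_nat_mono card_mono) auto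
  also have "\<dots> \<le> (\<Sum>e\<le>N. real (card (S P (Y / real (p ^ e)))))"
  proof -
    have "card (\<Union>e\<in>{..N}. (*) (p ^ e) ` S P (Y / real (p ^ e)))
        \<le> (\<Sum>e\<le>N. card ((*) (p ^ e) ` S P (Y / real (p ^ e))))" by (intro card_UN_le) auto
    also have "\<dots> \<le> (\<Sum>e\<le>N. card (S P (Y / real (p ^ e))))"
      by (intro sum_mono card_image_le finS)
    finally show ?thesis by (simp flip: of_nat_sum)
  qed
  also have "\<dots> \<le> (\<Sum>e\<le>N. Y powr \<eta> * K ^ card P * t ^ e)"
  proof (rule sum_mono)
    fix e
    have "real (card (S P (Y / real (p ^ e)))) \<le> (Y / real (p ^ e)) powr \<eta> * K ^ card P"
      unfolding S_def K_def using insert.prems by (intro insert.IH) auto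
    also have "(Y / real (p ^ e)) powr \<eta> = Y powr \<eta> * t ^ e"
    proof -
      have "(real p ^ e) powr \<eta> = (real p powr \<eta>) ^ e"
      proof -
        have "(real p ^ e) powr \<eta> = (real p powr real e) powr \<eta>"
          using p by (simp add: powr_realpow)
        also have "\<dots> = (real p powr \<eta>) powr real e" by (simp add: powr_powr mult.commute)
        also have "\<dots> = (real p powr \<eta>) ^ e" using p by (simp add: powr_realpow)
        finally show ?thesis .
      qed
      moreover have "(Y / real (p ^ e)) powr \<eta> = Y powr \<eta> / (real p ^ e) powr \<eta>"
        using insert.prems by (simp add: powr_divide)
      moreover have "t ^ e = 1 / (real p powr \<eta>) ^ e"
        unfolding t_def by (simp add: powr_minus_divide power_one_over)
      ultimately show ?thesis by simp
    qed
    finally show "real (card (S P (Y / real (p ^ e)))) \<le> Y powr \<eta> * K ^ card P * t ^ e"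
      by (simp add: mult_ac)
  qed
  also have "\<dots> = Y powr \<eta> * K ^ card P * (\<Sum>e\<le>N. t ^ e)" by (simp add: sum_distrib_left)
  also have "\<dots> \<le> Y powr \<eta> * K ^ card P * K"
  proof (rule mult_left_mono)
    have "(\<Sum>e\<le>N. t ^ e) = (1 - t ^ Suc N) / (1 - t)"
      using t1 t2 by (subst sum_gp0) auto
    also have "\<dots> \<le> 1 / (1 - t)" using t0 t1 t2 by (intro divide_right_mono) auto
    also have "\<dots> \<le> K" unfolding K_def using t0 t1 t2 by (intro divide_left_mono) auto
    finally show "(\<Sum>e\<le>N. t ^ e) \<le> K" .
  qed (use K0 in auto)
  finally show ?case using insert.hyps by (simp add: S_def K_def mult_ac)
qed

section \<open>Roots modulo q and lattice points\<close>

text \<open>In \<open>r ^ g - s ^ g = (r - s) * T\<close> the cofactor \<open>T\<close> is congruent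
  to \<open>g * s ^ (g - 1)\<close> modulo p^(v+1), where v is the multiplicity of p in g. As p does
  not divide s, it divides T at most v times, and the rest of p^k has to divide r - s.\<close>

lemma dvd_diff_of_dvd_diff_power:
  fixes r s :: int and p g k :: nat
  assumes p: "prime p" and g: "0 < g" and s: "\<not> int p dvd s"
    and rs: "int p ^ Suc (multiplicity p g) dvd r - s" and k: "int p ^ k dvd r ^ g - s ^ g"
  shows "int p ^ (k - multiplicity p g) dvd r - s"
proof (cases "r = s")
  case False
  define v where "v = multiplicity p g"
  define T where "T = (\<Sum>i<g. s ^ (g - Suc i) * r ^ i)"
  have pp: "prime (int p)" using p by simp
  have eq: "r ^ g - s ^ g = (r - s) * T" using power_diff_sumr2[of r g s] by (simp only: T_def)
  have T: "\<not> int p ^ Suc v dvd T"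
  proof (rule notI)
    assume d: "int p ^ Suc v dvd T"
    have "int p ^ Suc v dvd T - int g * s ^ (g - 1)"
    proof -
      have "s ^ (g - Suc i) * s ^ i = s ^ (g - 1)" if "i < g" for i
        using that by (simp flip: power_add)
      then have "T - int g * s ^ (g - 1) = (\<Sum>i<g. s ^ (g - Suc i) * (r ^ i - s ^ i))"
        unfolding T_def by (simp add: right_diff_distrib sum_subtractf)
      moreover have "int p ^ Suc v dvd r ^ i - s ^ i" for i
        unfolding power_diff_sumr2[of r i s] using rs unfolding v_def by (rule dvd_mult2)
      ultimately show ?thesis by (simp add: dvd_sum)
    qed
    then have "int p ^ Suc v dvd int g * s ^ (g - 1)"
      using dvd_diff[OF d] by fastforce
    moreover have "coprime (int p ^ Suc v) (s ^ (g - 1))"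
      using prime_imp_coprime[OF pp s] by (simp del: power_Suc)
    ultimately have "int p ^ Suc v dvd int g" by (simp add: coprime_dvd_mult_left_iff)
    then have "p ^ Suc v dvd g" by (simp only: of_nat_power [symmetric] int_dvd_int_iff)
    moreover have "\<not> is_unit p" using prime_gt_1_nat[OF p] by simp
    ultimately have "Suc v \<le> multiplicity p g"
      using g by (intro multiplicity_geI) auto
    then show False unfolding v_def by simp
  qed
  then have T0: "T \<noteq> 0" by auto
  have "k \<le> multiplicity (int p) ((r - s) * T)"
  proof (rule multiplicity_geI)
    show "(r - s) * T \<noteq> 0" using False T0 by simp
    show "int p ^ k dvd (r - s) * T" using k eq by simp
    show "\<not> is_unit (int p)" using pp not_prime_unit by blast
  qed
  also have "\<dots> = multiplicity (int p) (r - s) + multiplicity (int p) T"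
    using pp False T0 by (intro prime_elem_multiplicity_mult_distrib) auto
  also have "multiplicity (int p) T \<le> v"
  proof (rule ccontr)
    assume "\<not> multiplicity (int p) T \<le> v"
    then have "int p ^ Suc v dvd T" by (intro multiplicity_dvd') simp
    then show False using T by blast
  qed
  finally have "k - v \<le> multiplicity (int p) (r - s)" by simp
  then show ?thesis unfolding v_def by (rule multiplicity_dvd')
qed auto
text \<open>Let v be the multiplicity of p in g. The residue of r modulo p^(v+1), together with the
  equality of powers, fixes r modulo p^(k-v); what remains are at most p^v leading digits. There are
  at most g^2 residues and p^v is at most g. Admitting primes that divide g is what raises the bound
  from g to g^3.\<close>

lemma card_equal_powers_prime_power:
  fixes p k g :: nat and R :: "nat set"
  assumes p: "prime p" and g: "0 < g" and R: "R \<subseteq> {..<p ^ k}"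
    and cop: "\<And>r. r \<in> R \<Longrightarrow> \<not> p dvd r"
    and eq: "\<And>r s. r \<in> R \<Longrightarrow> s \<in> R \<Longrightarrow> [r ^ g = s ^ g] (mod p ^ k)"
  shows "card R \<le> g ^ 3"
proof (cases "k = 0")
  case True
  then have "card R \<le> card {..<1::nat}" using R by (intro card_mono) auto
  also have "\<dots> \<le> g ^ 3" using g by simp
  finally show ?thesis .
next
  case k: False
  define v where "v = multiplicity p g"
  have pv: "p ^ v \<le> g" unfolding v_def using g by (simp add: dvd_imp_le multiplicity_dvd)
  have p1: "p > 1" using p prime_gt_1_nat by blast
  define f where "f = (\<lambda>r. (r mod p ^ Suc v, r div p ^ (k - v)))"
  have finR: "finite R" using R finite_subset by blast
  have "inj_on f R"
  proof (rule inj_onI)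
    fix r s assume rs: "r \<in> R" "s \<in> R" "f r = f s"
    have 1: "int p ^ Suc v dvd int r - int s"
    proof -
      have "[int r = int s] (mod int (p ^ Suc v))"
        using rs(3) unfolding f_def cong_int_iff by (simp add: cong_def)
      then show ?thesis unfolding cong_iff_dvd_diff by (simp only: of_nat_power)
    qed
    have 2: "int p ^ k dvd int r ^ g - int s ^ g"
    proof -
      have "[int (r ^ g) = int (s ^ g)] (mod int (p ^ k))"
        using eq[OF rs(1,2)] unfolding cong_int_iff .
      then show ?thesis unfolding cong_iff_dvd_diff by (simp only: of_nat_power)
    qed
    have "int p ^ (k - v) dvd int r - int s"
    proof -
      have "\<not> int p dvd int s" using cop[OF rs(2)] by simp
      then show ?thesis
        using dvd_diff_of_dvd_diff_power[OF p g, of "int s" "int r" k] 1 2 unfolding v_def by blast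
    qed
    then have "r mod p ^ (k - v) = s mod p ^ (k - v)"
    proof -
      assume "int p ^ (k - v) dvd int r - int s"
      then have "[int r = int s] (mod int (p ^ (k - v)))" unfolding cong_iff_dvd_diff by simp
      then have "[r = s] (mod p ^ (k - v))" by (simp only: cong_int_iff)
      then show ?thesis by (simp only: cong_def)
    qed
    moreover have "r div p ^ (k - v) = s div p ^ (k - v)" using rs(3) by (simp add: f_def)
    ultimately show "r = s" by (metis div_mult_mod_eq)
  qed
  then have "card R = card (f ` R)" by (simp add: card_image)
  also have "\<dots> \<le> card (((\<lambda>r. r mod p ^ Suc v) ` R) \<times> {..<p ^ v})"
  proof (rule card_mono)
    show "f ` R \<subseteq> ((\<lambda>r. r mod p ^ Suc v) ` R) \<times> {..<p ^ v}"
    proof -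
      have "r div p ^ (k - v) < p ^ v" if "r \<in> R" for r
      proof -
        have "r < p ^ k" using that R by auto
        \<comment> \<open>Only an inequality, because \<open>k - v\<close> is cut off at 0 when
          \<open>k < v\<close>.\<close>
        also have "p ^ k \<le> p ^ (k - v + v)" using p1 by (intro power_increasing) auto
        also have "\<dots> = p ^ v * p ^ (k - v)" by (simp add: power_add)
        finally show ?thesis by (simp add: less_mult_imp_div_less)
      qed
      then show ?thesis by (auto simp: f_def)
    qed
  qed (use finR in auto)
  also have "\<dots> = card ((\<lambda>r. r mod p ^ Suc v) ` R) * p ^ v" by (simp add: card_cartesian_product)
  also have "\<dots> \<le> g\<^sup>2 * g"
  proof (rule mult_mono)
    show "card ((\<lambda>r. r mod p ^ Suc v) ` R) \<le> g\<^sup>2"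
    proof (cases "v = 0")
      \<comment> \<open>Here \<open>p\<close> does not divide \<open>g\<close>, and the residues are
        roots of a single equation modulo \<open>p\<close>.\<close>
      case True
      show ?thesis
      proof (cases "R = {}")
        case False
        then obtain s where s: "s \<in> R" by auto
        have "(\<lambda>r. r mod p ^ Suc v) ` R \<subseteq> {x\<in>{..<p}. [x ^ g = s ^ g] (mod p)}"
        proof -
          have "[(r mod p) ^ g = s ^ g] (mod p)" if "r \<in> R" for r
          proof -
            have "[r ^ g = s ^ g] (mod p)"
              using cong_dvd_modulus_nat[OF eq[OF that s] dvd_power] k by blast
            then show ?thesis by (simp add: cong_def power_mod)
          qed
          then show ?thesis using True p1 by auto
        qed
        then have "card ((\<lambda>r. r mod p ^ Suc v) ` R) \<le> card {x\<in>{..<p}. [x ^ g = s ^ g] (mod p)}"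
          by (intro card_mono) auto
        also have "\<dots> \<le> g" by (rule roots_mod_prime_bound[OF p g])
        finally show ?thesis using g by (simp add: power2_eq_square order_trans)
      qed auto
    next
      \<comment> \<open>Now \<open>p\<close> divides \<open>g\<close>, so both \<open>p\<close> and
        \<open>p ^ v\<close> are at most \<open>g\<close>, and counting all residues modulo
        \<open>p ^ Suc v\<close> is enough.\<close>
      case False
      have "card ((\<lambda>r. r mod p ^ Suc v) ` R) \<le> card {..<p ^ Suc v}"
        using p1 by (intro card_mono) auto
      also have "\<dots> = p * p ^ v" by simp
      also have "\<dots> \<le> g * g"
      proof (rule mult_mono)
        have "p ^ 1 \<le> p ^ v" using False p1 by (intro power_increasing) auto
        then show "p \<le> g" using pv by simp
      qed (use pv in auto)
      finally show ?thesis unfolding power2_eq_square .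
    qed
  qed (use pv in auto)
  finally show ?thesis by (simp add: power2_eq_square power3_eq_cube)
qed

text \<open>By the Chinese remainder theorem an element is determined by its residues modulo the
  prime powers exactly dividing \<open>q\<close>, and the previous bound applies to each of them.
  The exponential dependence on the number of primes is harmless by
  \<open>power_card_primes_le\<close>.\<close>

lemma card_equal_powers:
  fixes q g :: nat and R :: "nat set"
  assumes q: "0 < q" and g: "0 < g" and R: "R \<subseteq> {..<q}"
    and cop: "\<And>r. r \<in> R \<Longrightarrow> coprime r q"
    and eq: "\<And>r s. r \<in> R \<Longrightarrow> s \<in> R \<Longrightarrow> [r ^ g = s ^ g] (mod q)"
  shows "card R \<le> (g ^ 3) ^ card (prime_factors q)"
proof -
  define P where "P = prime_factors q"
  define m where "m = (\<lambda>p. p ^ multiplicity p q)"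
  define f where "f = (\<lambda>r. restrict (\<lambda>p. r mod m p) P)"
  have qm: "q = (\<Prod>p\<in>P. m p)" unfolding P_def m_def using q by (rule prime_factorization_nat)
  have inj: "inj_on f R"
  proof (rule inj_onI)
    fix r s assume rs: "r \<in> R" "s \<in> R" "f r = f s"
    have "[r = s] (mod m p)" if "p \<in> P" for p
      using fun_cong[OF rs(3), of p] that by (simp add: f_def cong_def)
    moreover have "coprime (m i) (m j)" if "i \<in> P" "j \<in> P" "i \<noteq> j" for i j
      using that unfolding P_def m_def
      by (auto intro: primes_coprime)
    ultimately have "[r = s] (mod (\<Prod>p\<in>P. m p))" by (intro coprime_cong_prod_nat) auto
    moreover have "r < q" "s < q" using rs R by auto
    ultimately show "r = s" using qm cong_less_modulus_unique_nat by metis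
  qed
  have "card R = card (f ` R)" using inj by (simp add: card_image)
  also have "\<dots> \<le> card (Pi\<^sub>E P (\<lambda>p. (\<lambda>r. r mod m p) ` R))"
  proof (rule card_mono)
    have "finite R" using R finite_subset by blast
    then show "finite (Pi\<^sub>E P (\<lambda>p. (\<lambda>r. r mod m p) ` R))" by (intro finite_PiE) (auto simp: P_def)
    show "f ` R \<subseteq> Pi\<^sub>E P (\<lambda>p. (\<lambda>r. r mod m p) ` R)" by (auto simp: f_def)
  qed
  also have "\<dots> = (\<Prod>p\<in>P. card ((\<lambda>r. r mod m p) ` R))" by (simp add: card_PiE P_def)
  also have "\<dots> \<le> (\<Prod>p\<in>P. g ^ 3)"
  proof (rule prod_mono, safe)
    fix p assume p: "p \<in> P"
    have pp: "prime p" "p dvd q" using p by (auto simp: P_def)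
    have mq: "m p dvd q" unfolding m_def by (rule multiplicity_dvd)
    have pm: "p dvd m p" unfolding m_def using pp q
      by (intro dvd_power) (auto simp: prime_multiplicity_gt_zero_iff)
    show "card ((\<lambda>r. r mod m p) ` R) \<le> g ^ 3"
    proof (rule card_equal_powers_prime_power[OF pp(1) g, where k = "multiplicity p q"])
      show "(\<lambda>r. r mod m p) ` R \<subseteq> {..<p ^ multiplicity p q}"
        using pp prime_gt_0_nat by (auto simp: m_def)
      show "\<not> p dvd r" if "r \<in> (\<lambda>r. r mod m p) ` R" for r
      proof
        assume d: "p dvd r"
        from that obtain s where s: "s \<in> R" "r = s mod m p" by auto
        have "p dvd s" using d s pm by (simp add: dvd_mod_iff)
        then show False using coprime_common_divisor[OF cop[OF s(1)] _ pp(2)] d prime_gt_1_nat[OF pp(1)]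
          by (metis \<open>p dvd s\<close> less_irrefl nat_dvd_1_iff_1)
      qed
      show "[r ^ g = s ^ g] (mod p ^ multiplicity p q)"
        if rs: "r \<in> (\<lambda>r. r mod m p) ` R" "s \<in> (\<lambda>r. r mod m p) ` R" for r s
      proof -
        from rs obtain r' s' where *: "r' \<in> R" "r = r' mod m p" "s' \<in> R" "s = s' mod m p" by auto
        have "[r' ^ g = s' ^ g] (mod m p)" using eq *(1,3) mq cong_dvd_modulus_nat by blast
        then show ?thesis using * by (simp add: cong_def power_mod m_def)
      qed
    qed
  qed
  also have "\<dots> = (g ^ 3) ^ card (prime_factors q)" by (simp add: P_def)
  finally show ?thesis .
qed

section \<open>Coprime lattice points are separated by slope\<close>

lemma card_separated_le:
  fixes T :: "real set" and d l :: real
  assumes "finite T" "0 < d" "0 \<le> l"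
    and sep: "\<And>s t. s \<in> T \<Longrightarrow> t \<in> T \<Longrightarrow> s \<noteq> t \<Longrightarrow> d \<le> \<bar>s - t\<bar>"
    and width: "\<And>s t. s \<in> T \<Longrightarrow> t \<in> T \<Longrightarrow> s - t \<le> l"
  shows "real (card T) \<le> 1 + l / d"
proof (cases "T = {}")
  case False
  define b where "b = Min T"
  have b: "b \<in> T" "\<And>t. t \<in> T \<Longrightarrow> b \<le> t" using False assms by (auto simp: b_def)
  define f where "f = (\<lambda>t. nat \<lfloor>(t - b) / d\<rfloor>)"
  have "inj_on f T"
  proof (rule inj_onI, rule ccontr)
    fix s t assume st: "s \<in> T" "t \<in> T" "f s = f t" "s \<noteq> t"
    have pos: "0 \<le> (s - b) / d" "0 \<le> (t - b) / d" using b st assms by auto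
    then have "\<lfloor>(s - b) / d\<rfloor> = \<lfloor>(t - b) / d\<rfloor>" using st(3) unfolding f_def
      by (metis int_nat_eq zero_le_floor)
    then have "\<bar>(s - b) / d - (t - b) / d\<bar> < 1" by linarith
    then have "\<bar>s - t\<bar> / d < 1" using assms by (simp add: diff_divide_distrib [symmetric] abs_divide)
    then show False using sep[OF st(1,2,4)] assms by (simp add: field_simps)
  qed
  then have "card T = card (f ` T)" by (simp add: card_image)
  also have "\<dots> \<le> card {..nat \<lfloor>l / d\<rfloor>}"
  proof (intro card_mono subsetI)
    fix x assume "x \<in> f ` T"
    then obtain t where t: "t \<in> T" "x = f t" by auto
    have "(t - b) / d \<le> l / d" using width[OF t(1) b(1)] assms by (intro divide_right_mono) auto
    then show "x \<in> {..nat \<lfloor>l / d\<rfloor>}" using t unfolding f_def by (auto intro!: nat_mono floor_mono)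
  qed auto
  also have "\<dots> = nat \<lfloor>l / d\<rfloor> + 1" by simp
  finally have "real (card T) \<le> real (nat \<lfloor>l / d\<rfloor>) + 1" by (simp flip: of_nat_Suc)
  also have "real (nat \<lfloor>l / d\<rfloor>) \<le> l / d" using assms by (intro of_nat_floor) auto
  finally show ?thesis by simp
qed (use assms in auto)

text \<open>Distinct coprime points with positive coordinates are not proportional, so the
  determinant of two of them is a nonzero multiple of \<open>q\<close>, and their slopes differ by
  at least \<open>q / P\<^sup>2\<close>. All slopes lie within a distance \<open>l\<close> of each
  other.\<close>

lemma card_lattice_points_le:
  fixes A :: "(nat \<times> nat) set" and q :: nat and P l :: real
  assumes "finite A" "0 < q" "0 \<le> l" "0 < P"
    and x: "\<And>x y. (x, y) \<in> A \<Longrightarrow> 0 < x \<and> real x \<le> P \<and> 0 < y \<and> coprime x y"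
    and dvd: "\<And>x y x' y'. (x, y) \<in> A \<Longrightarrow> (x', y') \<in> A \<Longrightarrow> int q dvd int x * int y' - int x' * int y"
    and slope: "\<And>x y x' y'. (x, y) \<in> A \<Longrightarrow> (x', y') \<in> A \<Longrightarrow> real y / real x - real y' / real x' \<le> l"
  shows "real (card A) \<le> 1 + l * P\<^sup>2 / real q"
proof -
  define f where "f = (\<lambda>z::nat\<times>nat. real (snd z) / real (fst z))"
  have sep: "z = z' \<or> real q / P\<^sup>2 \<le> \<bar>f z - f z'\<bar>" if "z \<in> A" "z' \<in> A" for z z'
  proof -
    obtain x y x' y' where z: "z = (x, y)" "z' = (x', y')" by (metis surj_pair)
    note X = x[of x y] x[of x' y']
    define D where "D = int x * int y' - int x' * int y"
    have "f z - f z' = - real_of_int D / (real x * real x')"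
      using X that unfolding f_def z D_def by (simp add: field_simps)
    then have fz: "\<bar>f z - f z'\<bar> = \<bar>real_of_int D\<bar> / (real x * real x')"
      by (simp add: abs_mult)
    show ?thesis
    proof (cases "D = 0")
      case True
      then have "x * y' = x' * y" unfolding D_def
        by (simp flip: of_nat_mult)
      moreover have "coprime x y" "coprime x' y'" "0 < x" "0 < x'" using X that z by auto
      ultimately have "x = x'" "y = y'"
        using coprime_crossproduct_nat[of x y x' y'] by simp_all
      then show ?thesis using z by simp
    next
      case False
      have "int q dvd D" unfolding D_def using dvd that z by blast
      then have "int q \<le> \<bar>D\<bar>" using False dvd_imp_le_int[of D "int q"] by simp
      then have "real q \<le> \<bar>real_of_int D\<bar>" by linarith
      moreover have "real x * real x' \<le> P\<^sup>2" using X that z unfolding power2_eq_square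
        by (intro mult_mono) auto
      moreover have "0 < real x * real x'" using X that z by auto
      ultimately show ?thesis unfolding fz by (intro disjI2 frac_le) auto
    qed
  qed
  have qP: "0 < real q / P\<^sup>2" using assms by simp
  have inj: "inj_on f A"
  proof (rule inj_onI, rule ccontr)
    fix z z' assume "z \<in> A" "z' \<in> A" "f z = f z'" "z \<noteq> z'"
    then show False using sep[of z z'] qP by simp
  qed
  have "real (card A) = real (card (f ` A))" using inj by (simp add: card_image)
  also have "\<dots> \<le> 1 + l / (real q / P\<^sup>2)"
  proof (rule card_separated_le)
    show "real q / P\<^sup>2 \<le> \<bar>s - t\<bar>" if "s \<in> f ` A" "t \<in> f ` A" "s \<noteq> t" for s t
      using that sep by auto
    show "s - t \<le> l" if "s \<in> f ` A" "t \<in> f ` A" for s t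
      using that slope by (auto simp: f_def)
  qed (use assms qP in auto)
  finally show ?thesis by simp
qed


section \<open>Decomposition by prime multiplicity\<close>

definition prime_class :: "nat \<Rightarrow> nat \<Rightarrow> nat set" where
  "prime_class i n = {p \<in> prime_factors n. min (multiplicity p n) 6 = i}"

(* n = (part 1 n) * ... * (part 6 n), where part i n is the i-th power of a squarefree number for
   i < 6, and part 6 n is 6-full. *)
definition part :: "nat \<Rightarrow> nat \<Rightarrow> nat" where
  "part i n = (\<Prod>p\<in>prime_class i n. p ^ multiplicity p n)"

definition block :: "nat set \<Rightarrow> nat \<Rightarrow> nat" where
  "block I n = (\<Prod>i\<in>I. part i n)"

lemma finite_prime_class [simp]: "finite (prime_class i n)"
  by (simp add: prime_class_def)

lemma prime_class_prime: "p \<in> prime_class i n \<Longrightarrow> prime p"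
  by (auto simp: prime_class_def)

lemma prime_factors_part [simp]: "prime_factors (part i n) = prime_class i n"
proof -
  have "multiplicity p (part i n) = (if p \<in> prime_class i n then multiplicity p n else 0)"
    if "prime p" for p
    unfolding part_def using that prime_class_prime by (intro multiplicity_prod_prime_powers) auto
  moreover have "0 < multiplicity p n" if "p \<in> prime_class i n" for p
    using that by (simp add: prime_class_def prime_factors_multiplicity)
  ultimately show ?thesis using prime_class_prime
    by (auto simp: prime_factors_multiplicity split: if_splits)
qed

lemma rad_part: "rad (part i n) = \<Prod>(prime_class i n)"
  by (simp add: rad_def)

lemma part_pos [simp]: "0 < part i n"
  unfolding part_def by (intro prod_pos) (auto dest: prime_class_prime prime_gt_0_nat)

lemma rad_pos [simp]: "0 < rad n"
  unfolding rad_def by (intro prod_pos) (simp add: prime_gt_0_nat in_prime_factors_imp_prime)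

lemma block_pos [simp]: "0 < block I n"
  unfolding block_def by (intro prod_pos) auto

lemma prime_factors_classes: "prime_factors n = (\<Union>i\<in>{1..6}. prime_class i n)"
  by (auto simp: prime_class_def prime_factors_multiplicity)

lemma disjoint_prime_class: "i \<noteq> j \<Longrightarrow> prime_class i n \<inter> prime_class j n = {}"
  by (auto simp: prime_class_def)

lemma block_all:
  assumes "0 < n"
  shows "block {1..6} n = n"
proof -
  have "n = (\<Prod>p\<in>prime_factors n. p ^ multiplicity p n)"
    using assms by (rule prime_factorization_nat)
  also have "\<dots> = (\<Prod>p\<in>(\<Union>i\<in>{1..6}. prime_class i n). p ^ multiplicity p n)"
    using prime_factors_classes by simp
  also have "\<dots> = block {1..6} n"
    unfolding block_def part_def using disjoint_prime_class by (intro prod.UNION_disjoint) auto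
  finally show ?thesis by simp
qed

lemma rad_classes:
  assumes "0 < n"
  shows "rad n = (\<Prod>i\<in>{1..6}. rad (part i n))"
proof -
  have "rad n = (\<Prod>p\<in>(\<Union>i\<in>{1..6}. prime_class i n). p)"
    unfolding rad_def using prime_factors_classes by simp
  also have "\<dots> = (\<Prod>i\<in>{1..6}. rad (part i n))"
    unfolding rad_part using disjoint_prime_class by (intro prod.UNION_disjoint) auto
  finally show ?thesis .
qed

lemma block_split:
  assumes "0 < n" "A \<subseteq> {1..6}"
  shows "block ({1..6} - A) n * block A n = n"
proof -
  have "block {1..6} n = block ({1..6} - A) n * block A n"
    unfolding block_def using assms by (intro prod.subset_diff) auto
  then show ?thesis using block_all[OF assms(1)] by simp
qed

lemma part_eq_rad_power: "i < 6 \<Longrightarrow> part i n = rad (part i n) ^ i"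
  unfolding rad_part unfolding part_def prod_power_distrib
  by (intro prod.cong) (auto simp: prime_class_def min_def split: if_splits)

lemma rad_power_le_part: "rad (part 6 n) ^ 6 \<le> part 6 n"
  unfolding rad_part unfolding part_def prod_power_distrib
proof (rule prod_mono, intro conjI)
  fix p assume p: "p \<in> prime_class 6 n"
  then have "6 \<le> multiplicity p n" by (auto simp: prime_class_def min_def split: if_splits)
  then show "p ^ 6 \<le> p ^ multiplicity p n"
    using prime_gt_0_nat[OF prime_class_prime[OF p]] by (intro power_increasing) auto
qed auto

text \<open>The source of the variables of the lattice argument: parts whose index is a multiple of
  \<open>g\<close> combine to one g-th power.\<close>

lemma block_eq_power:
  assumes "A \<subseteq> {1..5}" "\<And>i. i \<in> A \<Longrightarrow> g dvd i"
  shows "block A n = (\<Prod>i\<in>A. rad (part i n) ^ (i div g)) ^ g"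
  unfolding block_def prod_power_distrib
proof (rule prod.cong)
  fix i assume i: "i \<in> A"
  then have "i < 6" using assms(1) by auto
  then have "part i n = rad (part i n) ^ i" by (rule part_eq_rad_power)
  also have "\<dots> = (rad (part i n) ^ (i div g)) ^ g"
    using assms(2)[OF i] by (simp flip: power_mult)
  finally show "part i n = (rad (part i n) ^ (i div g)) ^ g" .
qed simp

lemma rad_dvd: "0 < n \<Longrightarrow> rad n dvd n"
  using prime_factorization_nat[of n] unfolding rad_def
  by (metis (no_types, lifting) dvd_power prod_dvd_prod prime_factors_multiplicity mem_Collect_eq)

lemma rad_le: "0 < n \<Longrightarrow> rad n \<le> n"
  using rad_dvd dvd_imp_le by blast

lemma block_dvd: "0 < n \<Longrightarrow> I \<subseteq> {1..6} \<Longrightarrow> block I n dvd n"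
  using block_split[of n I] by (metis dvd_triv_right)

lemma part_le: "0 < n \<Longrightarrow> i \<in> {1..6} \<Longrightarrow> part i n \<le> n"
  using block_dvd[of n "{i}"] by (simp add: block_def dvd_imp_le)

lemma prime_factors_rad: "prime_factors (rad n) = prime_factors n"
proof -
  have "multiplicity p (\<Prod>p\<in>prime_factors n. p ^ 1) = (if p \<in> prime_factors n then 1 else 0)"
    if "prime p" for p
    using that by (intro multiplicity_prod_prime_powers) auto
  then show ?thesis unfolding rad_def by (auto simp: prime_factors_multiplicity split: if_splits)
qed

lemma rad_mult_coprime:
  assumes "0 < a" "0 < b" "coprime a b"
  shows "rad (a * b) = rad a * rad b"
proof -
  have "prime_factors (a * b) = prime_factors a \<union> prime_factors b"
    using assms by (simp add: prime_factors_product)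
  moreover have "prime_factors a \<inter> prime_factors b = {}"
    using assms by (auto simp: prime_factors_dvd) (metis coprime_common_divisor_nat not_prime_1)
  ultimately show ?thesis unfolding rad_def by (simp add: prod.union_disjoint)
qed

text \<open>Sort by the radical. At most \<open>R\<close> radicals occur, and each is shared by few
  integers: one half of \<open>\<eta>\<close> pays for Rankin's bound, the other half for its factor
  \<open>K\<close> per prime.\<close>

lemma card_small_rad_le:
  fixes \<eta> :: real
  assumes "0 < \<eta>"
  shows "\<exists>C\<ge>1. \<forall>Y R::real. 1 \<le> Y \<longrightarrow> 0 \<le> R \<longrightarrow>
           real (card {s::nat. real s \<le> Y \<and> 0 < s \<and> real (rad s) \<le> R}) \<le> C * R * Y powr \<eta>"
proof -
  define K where "K = 1 / (1 - 2 powr - (\<eta>/2))"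
  have "2 powr - (\<eta>/2) < (1::real)" using assms by (simp add: powr_less_one)
  then have "1 \<le> K" unfolding K_def by simp
  then obtain C where C: "C \<ge> 1"
    "\<And>P::nat set. finite P \<Longrightarrow> (\<forall>p\<in>P. prime p) \<Longrightarrow> K ^ card P \<le> C * real (\<Prod>P) powr (\<eta>/2)"
    using power_card_primes_le[of K "\<eta>/2"] assms by auto
  have "real (card {s::nat. real s \<le> Y \<and> 0 < s \<and> real (rad s) \<le> R}) \<le> C * R * Y powr \<eta>"
    if Y: "1 \<le> Y" and R: "0 \<le> R" for Y R :: real
  proof -
    \<comment> \<open>The condition \<open>real r \<le> Y\<close> allows the power of
      \<open>rad r\<close> coming from \<open>C(2)\<close> to be absorbed into a power of
      \<open>Y\<close>.\<close>
    define T where "T = {r. 0 < r \<and> r \<le> nat \<lfloor>R\<rfloor> \<and> real r \<le> Y}"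
    define S where "S = (\<lambda>r::nat. {s::nat. real s \<le> Y \<and> 0 < s \<and> prime_factors s \<subseteq> prime_factors r})"
    have finT: "finite T" unfolding T_def by (rule finite_subset[of _ "{..nat \<lfloor>R\<rfloor>}"]) auto
    have sub: "{s::nat. real s \<le> Y \<and> 0 < s \<and> real (rad s) \<le> R} \<subseteq> (\<Union>r\<in>T. S r)"
    proof
      fix s assume s: "s \<in> {s::nat. real s \<le> Y \<and> 0 < s \<and> real (rad s) \<le> R}"
      then have "rad s \<in> T" using rad_le[of s] by (auto simp: T_def le_nat_floor)
      then show "s \<in> (\<Union>r\<in>T. S r)" using s prime_factors_rad[of s]
        by (intro UN_I[of "rad s"]) (auto simp: S_def)
    qed
    have "card {s::nat. real s \<le> Y \<and> 0 < s \<and> real (rad s) \<le> R} \<le> card (\<Union>r\<in>T. S r)"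
      using sub finT by (intro card_mono) (auto simp: S_def finite_bounded_nat)
    also have "\<dots> \<le> (\<Sum>r\<in>T. card (S r))" using finT by (rule card_UN_le)
    finally have "real (card {s::nat. real s \<le> Y \<and> 0 < s \<and> real (rad s) \<le> R}) \<le> (\<Sum>r\<in>T. real (card (S r)))"
      by (simp flip: of_nat_sum)
    also have "\<dots> \<le> (\<Sum>r\<in>T. C * Y powr \<eta>)"
    proof (rule sum_mono)
      fix r assume r: "r \<in> T"
      have "real (card (S r)) \<le> Y powr (\<eta>/2) * K ^ card (prime_factors r)"
        unfolding S_def K_def using assms Y by (intro card_smooth_le) auto
      also have "\<dots> \<le> Y powr (\<eta>/2) * (C * real (rad r) powr (\<eta>/2))"
        unfolding rad_def by (intro mult_left_mono C(2)) auto
      also have "\<dots> \<le> Y powr (\<eta>/2) * (C * Y powr (\<eta>/2))"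
      proof (intro mult_left_mono powr_mono2)
        show "real (rad r) \<le> Y" using r rad_le[of r] by (auto simp: T_def)
      qed (use assms C in auto)
      also have "\<dots> = C * Y powr \<eta>" by (simp add: powr_add [symmetric])
      finally show "real (card (S r)) \<le> C * Y powr \<eta>" .
    qed
    also have "\<dots> = real (card T) * (C * Y powr \<eta>)" by simp
    also have "\<dots> \<le> R * (C * Y powr \<eta>)"
    proof (rule mult_right_mono)
      have "card T \<le> card {1..nat \<lfloor>R\<rfloor>}" by (intro card_mono) (auto simp: T_def)
      then have "real (card T) \<le> real (nat \<lfloor>R\<rfloor>)" by simp
      also have "\<dots> \<le> R" using R by simp
      finally show "real (card T) \<le> R" .
    qed (use C in auto)
    finally show ?thesis by (simp add: mult_ac)
  qed
  then show ?thesis using C(1) by blast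
qed


section \<open>The lattice bound\<close>

(* The congruence modulo q confines the ratio x / y mod q to few residue classes, and each class
   is a lattice of determinant q.  The parameter tau measures how thin the cone containing the
   points is; tau = 1 is the trivial choice. *)
lemma card_proportional_pairs_le:
  fixes G :: "'a set" and U V x y :: "'a \<Rightarrow> nat" and q m n g :: nat and \<sigma> :: int and \<tau> P P' Q :: real
  assumes fin: "finite G" and q: "0 < q" and g: "0 < g"
    and U: "\<And>s. s \<in> G \<Longrightarrow> U s = m * x s ^ g" and V: "\<And>s. s \<in> G \<Longrightarrow> V s = n * y s ^ g"
    and dvd: "\<And>s. s \<in> G \<Longrightarrow> int q dvd int (U s) + \<sigma> * int (V s)"
    and cop: "\<And>s. s \<in> G \<Longrightarrow> coprime (U s) (V s) \<and> coprime (U s) q \<and> coprime (V s) q"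
    and pos: "\<And>s. s \<in> G \<Longrightarrow> 0 < U s \<and> 0 < V s"
    and inj: "inj_on (\<lambda>s. (x s, y s)) G"
    and bounds: "\<And>s. s \<in> G \<Longrightarrow> P' \<le> real (x s) \<and> real (x s) \<le> P \<and> real (y s) \<le> Q"
    and P': "0 < P'" and Q: "0 \<le> Q" and \<tau>: "0 \<le> \<tau>"
    and thin: "\<tau> = 1 \<or> (\<forall>s\<in>G. U s \<le> V s \<and> real (V s) \<le> (1 + \<tau>) * real (U s))"
  shows "real (card G) \<le> real ((g ^ 3) ^ card (prime_factors q)) * (1 + \<tau> * Q / P' * P\<^sup>2 / real q)"
proof (cases "G = {}")
  case True
  then show ?thesis using P' Q \<tau> by simp
next
  case False
  have xy: "0 < x s" "0 < y s" "coprime (x s) (y s)" "coprime (x s) q" "coprime (y s) q" "coprime m q"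
    if s: "s \<in> G" for s
  proof -
    have "coprime (m * x s ^ g) (n * y s ^ g)" "coprime (m * x s ^ g) q" "coprime (n * y s ^ g) q"
      using cop[OF s] U[OF s] V[OF s] by auto
    then show "coprime (x s) (y s)" "coprime (x s) q" "coprime (y s) q" "coprime m q"
      using g by auto
    show "0 < x s" "0 < y s" using pos[OF s] U[OF s] V[OF s] g by (auto intro!: Nat.gr0I simp: zero_power)
  qed
  obtain s0 where s0: "s0 \<in> G" using False by auto
  have P0: "0 < P" using bounds[OF s0] P' by linarith
  have Q0: "0 < Q" using bounds[OF s0] xy(2)[OF s0] by (meson less_le_trans of_nat_0_less_iff)
  \<comment> \<open>The quotient x / y as a residue modulo \<open>q\<close>; it makes sense because
    y is coprime to \<open>q\<close>.\<close>
  define ratio where "ratio = (\<lambda>s r. r < q \<and> [x s = r * y s] (mod q))"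
  have ex: "\<exists>r. ratio s r" if s: "s \<in> G" for s
  proof -
    obtain z where z: "[y s * z = 1] (mod q)" using cong_solve_coprime_nat[OF xy(5)[OF s]] by auto
    have "[x s * (y s * z) = x s * 1] (mod q)" using z by (rule cong_scalar_left)
    then have "[x s * z mod q * y s = x s] (mod q)"
      unfolding cong_def mod_mult_left_eq by (simp add: mult_ac)
    then show ?thesis unfolding ratio_def using q by (intro exI[of _ "x s * z mod q"]) (simp add: cong_sym)
  qed
  define r where "r = (\<lambda>s. SOME t. ratio s t)"
  have r: "r s < q" "[x s = r s * y s] (mod q)" if "s \<in> G" for s
    using someI_ex[OF ex[OF that]] unfolding r_def ratio_def by auto
  have ri: "int q dvd int (x s) - int (r s) * int (y s)" if "s \<in> G" for s
  proof -
    have "[int (x s) = int (r s * y s)] (mod int q)" using r(2)[OF that] by (simp only: cong_int_iff)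
    then show ?thesis by (simp add: cong_iff_dvd_diff)
  qed
  \<comment> \<open>Dividing by y^g, which is invertible modulo \<open>q\<close>, leaves one
    equation for the ratio that is the same for all of \<open>G\<close>.\<close>
  have root: "int q dvd int m * int (r s) ^ g + \<sigma> * int n" if s: "s \<in> G" for s
  proof -
    have 1: "[int (x s) ^ g = (int (r s) * int (y s)) ^ g] (mod int q)"
      using ri[OF s] by (intro cong_pow) (simp add: cong_iff_dvd_diff)
    have "[int m * int (x s) ^ g + \<sigma> * (int n * int (y s) ^ g)
        = int m * (int (r s) * int (y s)) ^ g + \<sigma> * (int n * int (y s) ^ g)] (mod int q)"
      using 1 by (intro cong_add cong_refl cong_scalar_left)
    moreover have "int q dvd int m * int (x s) ^ g + \<sigma> * (int n * int (y s) ^ g)"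
      using dvd[OF s] U[OF s] V[OF s] by simp
    ultimately have "int q dvd int m * (int (r s) * int (y s)) ^ g + \<sigma> * (int n * int (y s) ^ g)"
      using cong_dvd_iff by blast
    also have "\<dots> = (int m * int (r s) ^ g + \<sigma> * int n) * int (y s) ^ g"
      by (simp add: algebra_simps power_mult_distrib)
    finally show ?thesis
      using xy(5)[OF s] by (subst (asm) coprime_dvd_mult_left_iff) (auto simp: coprime_commute)
  qed
  \<comment> \<open>Two roots of this equation have congruent g-th powers because \<open>m\<close>
    is invertible modulo \<open>q\<close>.\<close>
  have cardR: "card (r ` G) \<le> (g ^ 3) ^ card (prime_factors q)"
  proof (rule card_equal_powers[OF q g])
    show "r ` G \<subseteq> {..<q}" using r by auto
    show "coprime t q" if "t \<in> r ` G" for t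
    proof -
      from that obtain s where s: "s \<in> G" "t = r s" by auto
      have "coprime (r s * y s) q" using r(2)[OF s(1)] xy(4)[OF s(1)] cong_imp_coprime by blast
      then show ?thesis using s by simp
    qed
    show "[t ^ g = t' ^ g] (mod q)" if t: "t \<in> r ` G" "t' \<in> r ` G" for t t'
    proof -
      from t obtain s s' where s: "s \<in> G" "t = r s" "s' \<in> G" "t' = r s'" by auto
      have "int q dvd (int m * int t ^ g + \<sigma> * int n) - (int m * int t' ^ g + \<sigma> * int n)"
        using root[OF s(1)] root[OF s(3)] s by (intro dvd_diff) auto
      also have "\<dots> = int m * (int (t ^ g) - int (t' ^ g))" by (simp add: algebra_simps)
      finally have "int q dvd int (t ^ g) - int (t' ^ g)"
        using xy(6)[OF s(1)] by (subst (asm) coprime_dvd_mult_right_iff) (auto simp: coprime_commute)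
      then have "[int (t ^ g) = int (t' ^ g)] (mod int q)" by (simp only: cong_iff_dvd_diff)
      then show ?thesis by (simp only: cong_int_iff)
    qed
  qed
  define b where "b = 1 + \<tau> * Q / P' * P\<^sup>2 / real q"
  have b0: "0 \<le> b" unfolding b_def using P' \<tau> Q0 by simp
  \<comment> \<open>All points with ratio \<open>t\<close> lie in the lattice given by x = t y
    modulo \<open>q\<close>, so their pairwise determinants are multiples of
    \<open>q\<close>.\<close>
  have fibre: "real (card {s\<in>G. r s = t}) \<le> b" for t
  proof -
    define H where "H = {s\<in>G. r s = t}"
    have H: "s \<in> G" "r s = t" if "s \<in> H" for s using that by (auto simp: H_def)
    have "card H = card ((\<lambda>s. (x s, y s)) ` H)"
      using inj by (intro card_image [symmetric] inj_on_subset[OF inj]) (auto simp: H_def)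
    also have "real \<dots> \<le> 1 + (\<tau> * Q / P') * P\<^sup>2 / real q"
    proof (rule card_lattice_points_le)
      show "finite ((\<lambda>s. (x s, y s)) ` H)" using fin by (simp add: H_def)
      show "0 < a \<and> real a \<le> P \<and> 0 < c \<and> coprime a c" if "(a, c) \<in> (\<lambda>s. (x s, y s)) ` H" for a c
        using that H xy bounds by auto
      show "int q dvd int a * int c' - int a' * int c"
        if "(a, c) \<in> (\<lambda>s. (x s, y s)) ` H" "(a', c') \<in> (\<lambda>s. (x s, y s)) ` H" for a c a' c'
      proof -
        from that obtain s s' where s: "s \<in> H" "a = x s" "c = y s" "s' \<in> H" "a' = x s'" "c' = y s'" by auto
        have "int q dvd int a - int t * int c" "int q dvd int a' - int t * int c'"
          using ri[OF H(1)[OF s(1)]] ri[OF H(1)[OF s(4)]] H(2)[OF s(1)] H(2)[OF s(4)] s by auto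
        then have "int q dvd (int a - int t * int c) * int c' - (int a' - int t * int c') * int c"
          by (rule dvd_diff[OF dvd_mult2 dvd_mult2])
        then show ?thesis by (simp add: algebra_simps)
      qed
      show "real c / real a - real c' / real a' \<le> \<tau> * Q / P'"
        if "(a, c) \<in> (\<lambda>s. (x s, y s)) ` H" "(a', c') \<in> (\<lambda>s. (x s, y s)) ` H" for a c a' c'
      proof -
        from that obtain s s' where s: "s \<in> G" "a = x s" "c = y s" "s' \<in> G" "a' = x s'" "c' = y s'"
          using H by auto
        have QP: "real (y z) / real (x z) \<le> Q / P'" if "z \<in> G" for z
          using bounds[OF that] P' by (intro frac_le) auto
        show ?thesis
        proof (cases "\<tau> = 1")
          case True
          have "real c / real a - real c' / real a' \<le> real c / real a" by simp
          also have "\<dots> \<le> \<tau> * Q / P'" using QP[OF s(1)] s True by simp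
          finally show ?thesis .
        next
          case False
          then have "U s \<le> V s" "U s' \<le> V s'" "real (V s) \<le> (1 + \<tau>) * real (U s)"
            using thin s by auto
          \<comment> \<open>For every point n (y / x)^g lies between m and (1 + \<tau>) m, so any
            two slopes differ at most by the factor 1 + \<tau>.\<close>
          then have le: "real n * real c ^ g \<le> (1 + \<tau>) * (real m * real a ^ g)"
            and ge: "real m * real a' ^ g \<le> real n * real c' ^ g"
            using U[OF s(1)] V[OF s(1)] U[OF s(4)] V[OF s(4)] s
            by (auto simp flip: of_nat_power of_nat_mult)
          have pos': "0 < a" "0 < a'" "0 < n" using xy(1) s pos[OF s(1)] V[OF s(1)] by auto
          have "real n * (real c / real a) ^ g = real n * real c ^ g / real a ^ g" by (simp add: power_divide)
          also have "\<dots> \<le> (1 + \<tau>) * real m"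
            using le pos' by (simp add: divide_le_eq mult_ac)
          also have "real m \<le> real n * (real c' / real a') ^ g"
            using ge pos' by (simp add: power_divide le_divide_eq mult_ac)
          finally have "real n * (real c / real a) ^ g \<le> real n * ((1 + \<tau>) * (real c' / real a') ^ g)"
            using \<tau> by (simp add: mult_left_mono mult_ac)
          then have "(real c / real a) ^ g \<le> (1 + \<tau>) * (real c' / real a') ^ g"
            using pos' by simp
          \<comment> \<open>A generous step that turns the right-hand side into a g-th power, so
            that roots can be taken.\<close>
          also have "\<dots> \<le> (1 + \<tau>) ^ g * (real c' / real a') ^ g"
            using \<tau> g by (intro mult_right_mono self_le_power) auto
          also have "\<dots> = ((1 + \<tau>) * (real c' / real a')) ^ g" by (simp only: power_mult_distrib)
          finally have "real c / real a \<le> (1 + \<tau>) * (real c' / real a')"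
            using g \<tau> by (subst (asm) power_mono_iff) auto
          moreover have "(1 + \<tau>) * z = z + \<tau> * z" for z by (simp add: distrib_right)
          ultimately have "real c / real a - real c' / real a' \<le> \<tau> * (real c' / real a')"
            by (simp only: diff_le_eq add.commute)
          also have "\<dots> \<le> \<tau> * (Q / P')" using QP[OF s(4)] s \<tau> by (intro mult_left_mono) auto
          finally show ?thesis by simp
        qed
      qed
    qed (use q P0 Q0 P' \<tau> in auto)
    finally show ?thesis unfolding b_def H_def .
  qed
  have "G = (\<Union>t\<in>r ` G. {s\<in>G. r s = t})" by auto
  then have "card G \<le> (\<Sum>t\<in>r ` G. card {s\<in>G. r s = t})"
    using card_UN_le[of "r ` G" "\<lambda>t. {s\<in>G. r s = t}"] fin by simp
  then have "real (card G) \<le> (\<Sum>t\<in>r ` G. real (card {s\<in>G. r s = t}))" by (simp flip: of_nat_sum)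
  also have "\<dots> \<le> real (card (r ` G)) * b" using sum_bounded_above[of "r ` G" _ b] fibre by simp
  also have "\<dots> \<le> real ((g ^ 3) ^ card (prime_factors q)) * b"
    using cardR b0 by (intro mult_right_mono of_nat_mono) auto
  finally show ?thesis unfolding b_def .
qed

(* Exponent of the bound for triples (U, V, W) obtained by fixing the parts of U outside A, those of
   V outside B and those of W in S.  The remaining parts of U and V are g-th powers x^g and y^g, and
   the fixed parts of W provide the modulus; z i is the exponent of the size of part i W. *)
definition lattice_exponent ::
  "nat \<Rightarrow> nat set \<Rightarrow> nat set \<Rightarrow> nat set \<Rightarrow> (nat \<Rightarrow> real) \<Rightarrow> (nat \<Rightarrow> real) \<Rightarrow> (nat \<Rightarrow> real) \<Rightarrow> (nat \<Rightarrow> real) \<Rightarrow> real" where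
  "lattice_exponent g A B S u v w z =
     (\<Sum>i\<in>{1..6}-A. u i) + (\<Sum>i\<in>{1..6}-B. v i) + (\<Sum>i\<in>S. w i)
     + max 0 (((\<Sum>i\<in>A. real i * u i) + (\<Sum>i\<in>B. real i * v i)) / real g - (\<Sum>i\<in>S. z i))"

text \<open>The size of \<open>part 6 n\<close> is deliberately not recorded, only its radical.
  Where that size matters, namely in the modulus, it enters \<open>card_fibre_le\<close> through the
  exponents \<open>z\<close> and the assumption \<open>size\<close>.\<close>

definition close_to :: "real \<Rightarrow> real \<Rightarrow> (nat \<Rightarrow> real) \<Rightarrow> nat \<Rightarrow> bool" where
  "close_to \<eta> X u n \<longleftrightarrow> 0 < n \<and> real n \<le> X \<and>
     (\<forall>i\<in>{1..6}. X powr (u i - \<eta>) \<le> real (rad (part i n)) \<and> real (rad (part i n)) \<le> X powr (u i + \<eta>))"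

text \<open>Each part contributes its radical exponent and a loss of \<open>2 * \<eta>\<close>: one
  \<open>\<eta>\<close> for the width of the box and one for counting integers of bounded radical. A
  block has at most six parts.\<close>

lemma card_block_image_le:
  fixes \<eta> X C :: real
  assumes \<eta>: "0 < \<eta>" and X: "1 \<le> X" and C: "1 \<le> C"
    and count: "\<And>Y R::real. 1 \<le> Y \<Longrightarrow> 0 \<le> R \<Longrightarrow>
           real (card {s::nat. real s \<le> Y \<and> 0 < s \<and> real (rad s) \<le> R}) \<le> C * R * Y powr \<eta>"
    and f: "\<And>s. s \<in> F \<Longrightarrow> close_to \<eta> X u (f s)" and I: "I \<subseteq> {1..6}"
  shows "real (card ((\<lambda>s. block I (f s)) ` F)) \<le> C ^ 6 * X powr ((\<Sum>i\<in>I. u i) + 12 * \<eta>)"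
proof -
  define S where "S = (\<lambda>i. {s::nat. real s \<le> X \<and> 0 < s \<and> real (rad s) \<le> X powr (u i + \<eta>)})"
  have finI: "finite I" using I finite_subset by blast
  have cI: "card I \<le> 6" using card_mono[OF _ I] by simp
  have finS: "finite (S i)" for i unfolding S_def by (rule finite_bounded_nat)
  have "(\<lambda>s. block I (f s)) ` F \<subseteq> (\<lambda>h. \<Prod>i\<in>I. h i) ` Pi\<^sub>E I S"
  proof
    fix t assume "t \<in> (\<lambda>s. block I (f s)) ` F"
    then obtain s where s: "s \<in> F" "t = block I (f s)" by auto
    have "part i (f s) \<in> S i" if i: "i \<in> I" for i
    proof -
      have "0 < f s" "real (f s) \<le> X" "real (rad (part i (f s))) \<le> X powr (u i + \<eta>)"
        using f[OF s(1)] i I unfolding close_to_def by auto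
      moreover have "part i (f s) \<le> f s" using part_le[of "f s" i] i I \<open>0 < f s\<close> by auto
      ultimately show ?thesis by (simp add: S_def)
    qed
    then have "restrict (\<lambda>i. part i (f s)) I \<in> Pi\<^sub>E I S" by auto
    moreover have "t = (\<Prod>i\<in>I. restrict (\<lambda>i. part i (f s)) I i)" using s by (simp add: block_def)
    ultimately show "t \<in> (\<lambda>h. \<Prod>i\<in>I. h i) ` Pi\<^sub>E I S" by blast
  qed
  then have "card ((\<lambda>s. block I (f s)) ` F) \<le> card ((\<lambda>h. \<Prod>i\<in>I. h i) ` Pi\<^sub>E I S)"
    using finI finS by (intro card_mono finite_imageI finite_PiE) auto
  also have "\<dots> \<le> card (Pi\<^sub>E I S)" using finI finS by (intro card_image_le finite_PiE) auto
  also have "\<dots> = (\<Prod>i\<in>I. card (S i))" using finI by (simp add: card_PiE)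
  finally have "real (card ((\<lambda>s. block I (f s)) ` F)) \<le> (\<Prod>i\<in>I. real (card (S i)))"
    by (simp flip: of_nat_prod)
  also have "\<dots> \<le> (\<Prod>i\<in>I. C * X powr (u i + 2 * \<eta>))"
  proof (rule prod_mono, intro conjI)
    fix i
    have "real (card (S i)) \<le> C * X powr (u i + \<eta>) * X powr \<eta>"
      unfolding S_def using X by (intro count) auto
    also have "\<dots> = C * (X powr (u i + \<eta>) * X powr \<eta>)" by simp
    also have "X powr (u i + \<eta>) * X powr \<eta> = X powr (u i + 2 * \<eta>)"
      unfolding powr_add [symmetric] by (simp add: algebra_simps)
    finally show "real (card (S i)) \<le> C * X powr (u i + 2 * \<eta>)" .
  qed auto
  also have "\<dots> = C ^ card I * X powr (\<Sum>i\<in>I. u i + 2 * \<eta>)"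
    using X finI by (simp add: prod.distrib powr_sum)
  also have "\<dots> \<le> C ^ 6 * X powr ((\<Sum>i\<in>I. u i) + 12 * \<eta>)"
  proof (intro mult_mono power_increasing powr_mono)
    have "real (card I) * (2 * \<eta>) \<le> 6 * (2 * \<eta>)" using cI \<eta> by (intro mult_right_mono) auto
    then show "(\<Sum>i\<in>I. u i + 2 * \<eta>) \<le> (\<Sum>i\<in>I. u i) + 12 * \<eta>" by (simp add: sum.distrib)
  qed (use cI X C in auto)
  finally show ?thesis .
qed

text \<open>The slack 15 is 1 + 2 + 3 + 4 + 5: each radical is known up to a factor
  \<open>X powr \<eta>\<close> and enters with a power at most its index.\<close>

lemma prod_rad_bounds:
  assumes n: "close_to \<eta> X u n" and \<eta>: "0 < \<eta>" and X: "1 \<le> X"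
    and A: "A \<subseteq> {1..5}" and c: "\<And>i. i \<in> A \<Longrightarrow> c i \<le> i"
  shows "X powr ((\<Sum>i\<in>A. real (c i) * u i) - 15 * \<eta>) \<le> real (\<Prod>i\<in>A. rad (part i n) ^ c i)"
    and "real (\<Prod>i\<in>A. rad (part i n) ^ c i) \<le> X powr ((\<Sum>i\<in>A. real (c i) * u i) + 15 * \<eta>)"
proof -
  have finA: "finite A" using A finite_subset by blast
  have X0: "X \<noteq> 0" using X by auto
  have "(\<Sum>i\<in>A. real (c i)) \<le> (\<Sum>i\<in>A. real i)" using c by (intro sum_mono) auto
  also have "\<dots> \<le> (\<Sum>i\<in>{1..5}. real i)" using A by (intro sum_mono2) auto
  also have "\<dots> = 15" by (simp add: numeral_eq_Suc)
  finally have le: "(\<Sum>i\<in>A. real (c i)) * \<eta> \<le> 15 * \<eta>" using \<eta> by (intro mult_right_mono) auto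
  have eq: "X powr (\<Sum>i\<in>A. real (c i) * t i) = (\<Prod>i\<in>A. (X powr t i) ^ c i)" for t
    unfolding powr_sum[OF X0]
    using X by (intro prod.cong) (auto simp: powr_power)
  have b: "X powr (u i - \<eta>) \<le> real (rad (part i n)) \<and> real (rad (part i n)) \<le> X powr (u i + \<eta>)"
    if "i \<in> A" for i
    using n A that unfolding close_to_def by force
  have "X powr ((\<Sum>i\<in>A. real (c i) * u i) - 15 * \<eta>) \<le> X powr (\<Sum>i\<in>A. real (c i) * (u i - \<eta>))"
    using le X by (intro powr_mono) (simp_all add: right_diff_distrib sum_subtractf sum_distrib_right)
  also have "\<dots> \<le> (\<Prod>i\<in>A. real (rad (part i n)) ^ c i)"
    unfolding eq using b by (intro prod_mono) (auto intro: power_mono)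
  finally show "X powr ((\<Sum>i\<in>A. real (c i) * u i) - 15 * \<eta>) \<le> real (\<Prod>i\<in>A. rad (part i n) ^ c i)"
    by simp
  have "(\<Prod>i\<in>A. real (rad (part i n)) ^ c i) \<le> X powr (\<Sum>i\<in>A. real (c i) * (u i + \<eta>))"
    unfolding eq using b by (intro prod_mono) (auto intro: power_mono)
  also have "\<dots> \<le> X powr ((\<Sum>i\<in>A. real (c i) * u i) + 15 * \<eta>)"
    using le X by (intro powr_mono) (simp_all add: distrib_left sum.distrib sum_distrib_right)
  finally show "real (\<Prod>i\<in>A. rad (part i n) ^ c i) \<le> X powr ((\<Sum>i\<in>A. real (c i) * u i) + 15 * \<eta>)"
    by simp
qed

text \<open>The number of choices of the fixed factors, from \<open>card_block_image_le\<close>, is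
  multiplied by the number of triples for each choice, from
  \<open>card_proportional_pairs_le\<close>. The assumption \<open>size\<close> bounds the effective
  modulus q / \<tau> from below by the exponents \<open>z\<close>. So \<open>z\<close> may overstate
  the size of the fixed parts of W provided that the cone is thin enough to make up for it.\<close>

lemma card_fibre_le:
  fixes \<eta> X C C' \<tau> :: real and F :: "'a set" and U V W :: "'a \<Rightarrow> nat" and \<sigma> :: int
  assumes \<eta>: "0 < \<eta>" and X: "1 \<le> X" and C: "1 \<le> C" "1 \<le> C'"
    and count: "\<And>Y R::real. 1 \<le> Y \<Longrightarrow> 0 \<le> R \<Longrightarrow>
           real (card {s::nat. real s \<le> Y \<and> 0 < s \<and> real (rad s) \<le> R}) \<le> C * R * Y powr \<eta>"
    and roots: "\<And>P::nat set. finite P \<Longrightarrow> (\<forall>p\<in>P. prime p) \<Longrightarrow> 125 ^ card P \<le> C' * real (\<Prod>P) powr \<eta>"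
    and fin: "finite F" and g: "g \<in> {1..5}" and AB: "A \<subseteq> {1..5}" "B \<subseteq> {1..5}" "\<And>i. i \<in> A \<union> B \<Longrightarrow> g dvd i"
    and S: "S \<subseteq> {1..6}"
    and cl: "\<And>s. s \<in> F \<Longrightarrow> close_to \<eta> X u (U s) \<and> close_to \<eta> X v (V s) \<and> close_to \<eta> X w (W s)"
    and cop: "\<And>s. s \<in> F \<Longrightarrow> coprime (U s) (V s) \<and> coprime (U s) (W s) \<and> coprime (V s) (W s)"
    and dvd: "\<And>s. s \<in> F \<Longrightarrow> int (W s) dvd int (U s) + \<sigma> * int (V s)"
    and inj: "inj_on (\<lambda>s. (U s, V s)) F"
    and \<tau>: "0 \<le> \<tau>" "\<tau> = 1 \<or> (\<forall>s\<in>F. U s \<le> V s \<and> real (V s) \<le> (1 + \<tau>) * real (U s))"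
    and size: "\<And>s. s \<in> F \<Longrightarrow> \<tau> \<le> X powr (20 * \<eta> - (\<Sum>i\<in>S. z i)) * real (block S (W s))"
  shows "real (card F) \<le> 2 * C ^ 18 * C' * X powr (lattice_exponent g A B S u v w z + 120 * \<eta>)"
proof -
  define A' B' where "A' = {1..6} - A" and "B' = {1..6} - B"
  define pu pv where "pu = (\<Sum>i\<in>A. real (i div g) * u i)" and "pv = (\<Sum>i\<in>B. real (i div g) * v i)"
  define E where "E = pu + pv - (\<Sum>i\<in>S. z i)"
  define x y where "x = (\<lambda>s. \<Prod>i\<in>A. rad (part i (U s)) ^ (i div g))"
    and "y = (\<lambda>s. \<Prod>i\<in>B. rad (part i (V s)) ^ (i div g))"
  \<comment> \<open>The data to be fixed; the remaining freedom is the pair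
    \<open>(x s, y s)\<close>.\<close>
  define d where "d = (\<lambda>s. (block A' (U s), block B' (V s), block S (W s)))"
  have pos: "0 < U s" "0 < V s" "0 < W s" if "s \<in> F" for s
    using cl[OF that] unfolding close_to_def by auto
  have Ux: "U s = block A' (U s) * x s ^ g" if s: "s \<in> F" for s
  proof -
    have "A \<subseteq> {1..6}" using AB(1) by auto
    then have "U s = block A' (U s) * block A (U s)" using block_split[OF pos(1)[OF s]] by (simp add: A'_def)
    moreover have "block A (U s) = x s ^ g" unfolding x_def using AB by (intro block_eq_power) auto
    ultimately show ?thesis by simp
  qed
  have Vy: "V s = block B' (V s) * y s ^ g" if s: "s \<in> F" for s
  proof -
    have "B \<subseteq> {1..6}" using AB(2) by auto
    then have "V s = block B' (V s) * block B (V s)" using block_split[OF pos(2)[OF s]] by (simp add: B'_def)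
    moreover have "block B (V s) = y s ^ g" unfolding y_def using AB by (intro block_eq_power) auto
    ultimately show ?thesis by simp
  qed
  \<comment> \<open>Of the 81, 60 come from the box widths (15 for each of the four factors Q, 1 /
    P', P and P), 20 from \<open>size\<close> and 1 from the roots modulo \<open>q\<close>. The
    fixed data will add 3 * 12 = 36, and the total 117 is rounded up to 120.\<close>
  define bd where "bd = 2 * C' * X powr (81 * \<eta> + max 0 E)"
  have fibre: "real (card {s\<in>F. d s = (m, n, q)}) \<le> bd" if q0: "(m, n, q) \<in> d ` F" for m n q
  proof -
    obtain t where t: "t \<in> F" "d t = (m, n, q)" using q0 by force
    define G where "G = {s\<in>F. d s = (m, n, q)}"
    have G: "s \<in> F" "m = block A' (U s)" "n = block B' (V s)" "q = block S (W s)" if "s \<in> G" for s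
      using that by (auto simp: G_def d_def)
    have q: "0 < q" using t by (auto simp: d_def)
    have qW: "q dvd W s" if "s \<in> G" for s
      using G[OF that] block_dvd[OF pos(3) S] by simp
    have "real (card G) \<le> real ((g ^ 3) ^ card (prime_factors q)) *
        (1 + \<tau> * X powr (pv + 15 * \<eta>) / X powr (pu - 15 * \<eta>) * (X powr (pu + 15 * \<eta>))\<^sup>2 / real q)"
    proof (rule card_proportional_pairs_le)
      show "U s = m * x s ^ g" "V s = n * y s ^ g" if "s \<in> G" for s
        using Ux Vy G[OF that] by auto
      show "int q dvd int (U s) + \<sigma> * int (V s)" if "s \<in> G" for s
        using dvd[OF G(1)[OF that]] qW[OF that] by (meson dvd_trans of_nat_dvd_iff)
      show "coprime (U s) (V s) \<and> coprime (U s) q \<and> coprime (V s) q" if "s \<in> G" for s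
        using cop[OF G(1)[OF that]] coprime_divisors[OF dvd_refl qW[OF that]] by auto
      show "0 < U s \<and> 0 < V s" if "s \<in> G" for s using pos G(1)[OF that] by auto
      show "inj_on (\<lambda>s. (x s, y s)) G"
      proof (rule inj_onI)
        fix s s' assume s: "s \<in> G" "s' \<in> G" "(x s, y s) = (x s', y s')"
        then have "U s = m * x s ^ g" "U s' = m * x s ^ g" "V s = n * y s ^ g" "V s' = n * y s ^ g"
          using Ux[OF G(1)[OF s(1)]] Ux[OF G(1)[OF s(2)]] Vy[OF G(1)[OF s(1)]] Vy[OF G(1)[OF s(2)]]
            G(2,3)[OF s(1)] G(2,3)[OF s(2)] by simp_all
        then show "s = s'" using inj_onD[OF inj _ G(1)[OF s(1)] G(1)[OF s(2)]] by simp
      qed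
      show "X powr (pu - 15 * \<eta>) \<le> real (x s) \<and> real (x s) \<le> X powr (pu + 15 * \<eta>) \<and>
          real (y s) \<le> X powr (pv + 15 * \<eta>)" if "s \<in> G" for s
        using prod_rad_bounds[of \<eta> X u "U s" A "\<lambda>i. i div g"] prod_rad_bounds[of \<eta> X v "V s" B "\<lambda>i. i div g"]
          cl[OF G(1)[OF that]] \<eta> X AB
        unfolding x_def y_def pu_def pv_def by simp
      show "\<tau> = 1 \<or> (\<forall>s\<in>G. U s \<le> V s \<and> real (V s) \<le> (1 + \<tau>) * real (U s))"
        using \<tau> G(1) by blast
    qed (use fin q g X \<tau> in \<open>auto simp: G_def\<close>)
    also have "\<dots> \<le> (C' * X powr \<eta>) * (2 * X powr (80 * \<eta> + max 0 E))"
    proof (intro mult_mono)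
      \<comment> \<open>Since \<open>g \<le> 5\<close>, the root count is at most 125 per prime,
        which is the constant in \<open>roots\<close>.\<close>
      have "real ((g ^ 3) ^ card (prime_factors q)) \<le> real ((5 ^ 3) ^ card (prime_factors q))"
        using g by (intro of_nat_mono power_mono) auto
      also have "\<dots> = 125 ^ card (prime_factors q)" by simp
      also have "\<dots> \<le> C' * real (rad q) powr \<eta>" unfolding rad_def by (intro roots) auto
      also have "\<dots> \<le> C' * X powr \<eta>"
      proof (intro mult_left_mono powr_mono2)
        have "q \<le> W t" using qW[of t] t pos(3)[OF t(1)] by (auto simp: G_def intro: dvd_imp_le)
        then show "real (rad q) \<le> X" using cl[OF t(1)] rad_le[OF q] unfolding close_to_def by linarith
      qed (use \<eta> C in auto)
      finally show "real ((g ^ 3) ^ card (prime_factors q)) \<le> C' * X powr \<eta>" .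
      have "\<tau> / real q \<le> X powr (20 * \<eta> - (\<Sum>i\<in>S. z i))"
        using size[OF t(1)] t q by (auto simp: d_def divide_le_eq)
      then have "X powr (pu + pv + 60 * \<eta>) * (\<tau> / real q)
          \<le> X powr (pu + pv + 60 * \<eta>) * X powr (20 * \<eta> - (\<Sum>i\<in>S. z i))"
        by (intro mult_left_mono) auto
      also have "\<dots> = X powr (80 * \<eta> + E)" unfolding powr_add [symmetric] E_def
        by (rule arg_cong[of _ _ "\<lambda>e. X powr e"]) simp
      also have "\<dots> \<le> X powr (80 * \<eta> + max 0 E)" using X by (intro powr_mono) auto
      finally have "X powr (pu + pv + 60 * \<eta>) * (\<tau> / real q) \<le> X powr (80 * \<eta> + max 0 E)" .
      moreover have "\<tau> * X powr (pv + 15 * \<eta>) / X powr (pu - 15 * \<eta>) * (X powr (pu + 15 * \<eta>))\<^sup>2 / real q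
          = X powr (pu + pv + 60 * \<eta>) * (\<tau> / real q)"
      proof -
        have "X powr (pv + 15 * \<eta>) / X powr (pu - 15 * \<eta>) * (X powr (pu + 15 * \<eta>))\<^sup>2
            = X powr (pu + pv + 60 * \<eta>)"
          unfolding power2_eq_square powr_diff [symmetric] powr_add [symmetric]
          by (rule arg_cong[of _ _ "\<lambda>e. X powr e"]) simp
        moreover have "\<tau> * a / b * c / r = (a / b * c) * (\<tau> / r)" for a b c r :: real by simp
        ultimately show ?thesis by (simp only:)
      qed
      moreover have "1 \<le> X powr (80 * \<eta> + max 0 E)" using X \<eta> by (intro ge_one_powr_ge_zero) auto
      ultimately show "1 + \<tau> * X powr (pv + 15 * \<eta>) / X powr (pu - 15 * \<eta>) * (X powr (pu + 15 * \<eta>))\<^sup>2 / real q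
          \<le> 2 * X powr (80 * \<eta> + max 0 E)" by linarith
    qed (use C X \<tau> in auto)
    also have "\<dots> = bd"
    proof -
      have "X powr \<eta> * X powr (80 * \<eta> + max 0 E) = X powr (81 * \<eta> + max 0 E)"
        unfolding powr_add [symmetric] by (rule arg_cong[of _ _ "\<lambda>e. X powr e"]) simp
      then show ?thesis unfolding bd_def by (simp add: mult_ac)
    qed
    finally show ?thesis unfolding G_def .
  qed
  have I: "A' \<subseteq> {1..6}" "B' \<subseteq> {1..6}" by (auto simp: A'_def B'_def)
  have finD: "finite (d ` F)" using fin by simp
  define sU sV sW where "sU = (\<Sum>i\<in>A'. u i)" and "sV = (\<Sum>i\<in>B'. v i)" and "sW = (\<Sum>i\<in>S. w i)"
  have cardD: "real (card (d ` F)) \<le> C ^ 18 * X powr (sU + sV + sW + 36 * \<eta>)"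
  proof -
    have "card (d ` F) \<le> card ((\<lambda>s. block A' (U s)) ` F \<times> (\<lambda>s. block B' (V s)) ` F \<times> (\<lambda>s. block S (W s)) ` F)"
      using fin by (intro card_mono) (auto simp: d_def)
    also have "\<dots> = card ((\<lambda>s. block A' (U s)) ` F) * (card ((\<lambda>s. block B' (V s)) ` F) * card ((\<lambda>s. block S (W s)) ` F))"
      by (simp add: card_cartesian_product)
    finally have "real (card (d ` F)) \<le> real (card ((\<lambda>s. block A' (U s)) ` F)) *
        (real (card ((\<lambda>s. block B' (V s)) ` F)) * real (card ((\<lambda>s. block S (W s)) ` F)))"
      by (simp flip: of_nat_mult)
    also have "\<dots> \<le> (C ^ 6 * X powr (sU + 12 * \<eta>)) * ((C ^ 6 * X powr (sV + 12 * \<eta>)) * (C ^ 6 * X powr (sW + 12 * \<eta>)))"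
      unfolding sU_def sV_def sW_def using cl C(1) X \<eta>
      by (intro mult_mono card_block_image_le[OF \<eta> X C(1) count] I S mult_nonneg_nonneg) auto
    also have "\<dots> = C ^ 18 * X powr (sU + sV + sW + 36 * \<eta>)"
    proof -
      have "X powr (sU + 12 * \<eta>) * (X powr (sV + 12 * \<eta>) * X powr (sW + 12 * \<eta>)) = X powr (sU + sV + sW + 36 * \<eta>)"
        unfolding powr_add [symmetric] by (rule arg_cong[of _ _ "\<lambda>e. X powr e"]) simp
      moreover have "(C ^ 6 * a) * ((C ^ 6 * b) * (C ^ 6 * c)) = C ^ 18 * (a * (b * c))" for a b c
        by (simp add: algebra_simps flip: power_add)
      ultimately show ?thesis by (simp only:)
    qed
    finally show ?thesis .
  qed
  have "F = (\<Union>k\<in>d ` F. {s\<in>F. d s = k})" by auto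
  then have "card F \<le> (\<Sum>k\<in>d ` F. card {s\<in>F. d s = k})"
    using card_UN_le[OF finD, of "\<lambda>k. {s\<in>F. d s = k}"] by simp
  then have "real (card F) \<le> (\<Sum>k\<in>d ` F. real (card {s\<in>F. d s = k}))" by (simp flip: of_nat_sum)
  also have "\<dots> \<le> real (card (d ` F)) * bd"
  proof (rule sum_bounded_above)
    fix k assume "k \<in> d ` F"
    then show "real (card {s\<in>F. d s = k}) \<le> bd" using fibre by (cases k) auto
  qed
  also have "\<dots> \<le> (C ^ 18 * X powr (sU + sV + sW + 36 * \<eta>)) * bd"
    using cardD C by (intro mult_right_mono) (auto simp: bd_def)
  also have "\<dots> = 2 * C ^ 18 * C' * X powr (sU + sV + sW + max 0 E + 117 * \<eta>)"
  proof -
    have "X powr (sU + sV + sW + 36 * \<eta>) * X powr (81 * \<eta> + max 0 E) = X powr (sU + sV + sW + max 0 E + 117 * \<eta>)"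
      unfolding powr_add [symmetric] by (rule arg_cong[of _ _ "\<lambda>e. X powr e"]) simp
    then show ?thesis unfolding bd_def by (simp add: mult_ac)
  qed
  also have "\<dots> \<le> 2 * C ^ 18 * C' * X powr (lattice_exponent g A B S u v w z + 120 * \<eta>)"
  proof (intro mult_left_mono powr_mono)
    have "pu = (\<Sum>i\<in>A. real i * u i) / real g"
      unfolding pu_def sum_divide_distrib using AB g by (intro sum.cong) (auto simp: real_of_nat_div)
    moreover have "pv = (\<Sum>i\<in>B. real i * v i) / real g"
      unfolding pv_def sum_divide_distrib using AB g by (intro sum.cong) (auto simp: real_of_nat_div)
    ultimately have "lattice_exponent g A B S u v w z = sU + sV + sW + max 0 E"
      unfolding lattice_exponent_def sU_def sV_def sW_def E_def A'_def B'_def by (simp add: add_divide_distrib)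
    then show "sU + sV + sW + max 0 E + 117 * \<eta> \<le> lattice_exponent g A B S u v w z + 120 * \<eta>"
      using \<eta> by simp
  qed (use X C in auto)
  finally show ?thesis .
qed


section \<open>Optimising the exponents\<close>

(* A profile u encodes a number n of size X: u i is the exponent of rad (part i n) for i = 1, ..., 6,
   and u 0 is the exponent of part 6 n itself. *)
definition part_size :: "(nat \<Rightarrow> real) \<Rightarrow> nat \<Rightarrow> real" where
  "part_size u i = (if i = 6 then u 0 else real i * u i)"

definition profile :: "(nat \<Rightarrow> real) \<Rightarrow> bool" where
  "profile u \<longleftrightarrow> (\<forall>i. 0 \<le> u i) \<and> 6 * u 6 \<le> u 0 \<and> (\<Sum>i\<in>{1..6}. part_size u i) = 1"

definition admissible :: "nat \<Rightarrow> nat set \<Rightarrow> nat set \<Rightarrow> nat set \<Rightarrow> bool" where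
  "admissible g A B S \<longleftrightarrow> g \<in> {1..5} \<and> A \<subseteq> {1..5} \<and> B \<subseteq> {1..5} \<and> (\<forall>i\<in>A \<union> B. g dvd i) \<and> S \<subseteq> {1..6}"

definition exceeds :: "real \<Rightarrow> (nat \<Rightarrow> real) \<Rightarrow> (nat \<Rightarrow> real) \<Rightarrow> (nat \<Rightarrow> real) \<Rightarrow> bool" where
  "exceeds \<theta> u v w \<longleftrightarrow> (\<forall>g A B S. admissible g A B S \<longrightarrow> \<theta> < lattice_exponent g A B S u v w (part_size w))"

text \<open>The situation to be refuted: a box of exponents for which no lattice bound gets down to
  \<open>\<theta>\<close>. Three choices of the number supplying the modulus cover all six orders,
  because the bound is symmetric in the other two numbers.\<close>

definition all_exceed :: "real \<Rightarrow> real \<Rightarrow> (nat \<Rightarrow> real) \<Rightarrow> (nat \<Rightarrow> real) \<Rightarrow> (nat \<Rightarrow> real) \<Rightarrow> bool" where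
  "all_exceed \<theta> lam u v w \<longleftrightarrow> profile u \<and> profile v \<and> profile w \<and>
     (\<Sum>i\<in>{1..6}. u i) + (\<Sum>i\<in>{1..6}. v i) + (\<Sum>i\<in>{1..6}. w i) \<le> lam \<and>
     exceeds \<theta> u v w \<and> exceeds \<theta> v w u \<and> exceeds \<theta> u w v"

lemma exceeds_commute: "exceeds \<theta> u v w \<longleftrightarrow> exceeds \<theta> v u w"
proof -
  have "exceeds \<theta> v u w" if "exceeds \<theta> u v w" for u v
    unfolding exceeds_def
  proof (intro allI impI)
    fix g A B S assume "admissible g A B S"
    then have "admissible g B A S" by (auto simp: admissible_def)
    then have "\<theta> < lattice_exponent g B A S u v w (part_size w)" using that by (simp add: exceeds_def)
    then show "\<theta> < lattice_exponent g A B S v u w (part_size w)" by (simp add: lattice_exponent_def add_ac)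
  qed
  then show ?thesis by blast
qed

lemma all_exceed_perms:
  assumes "all_exceed \<theta> lam u v w"
  shows "all_exceed \<theta> lam u v w" "all_exceed \<theta> lam u w v" "all_exceed \<theta> lam v u w"
    "all_exceed \<theta> lam v w u" "all_exceed \<theta> lam w u v" "all_exceed \<theta> lam w v u"
  using assms exceeds_commute[of \<theta>] unfolding all_exceed_def by auto

lemma interval_expansions:
  "{1..6::nat} = {1, 2, 3, 4, 5, 6}" "{1..5::nat} = {1, 2, 3, 4, 5}"
  by auto

text \<open>The maximum inside \<open>lattice_exponent\<close> becomes a disjunction of linear
  inequalities. Passing the two sums as equations for \<open>b\<close> and \<open>e\<close> lets
  each application state them fully expanded, ready for linear arithmetic.\<close>

lemma all_exceed_lattice:
  assumes "all_exceed \<theta> lam u v w" "admissible g A B S"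
    and "(\<Sum>i\<in>{1..6}-A. u i) + (\<Sum>i\<in>{1..6}-B. v i) + (\<Sum>i\<in>S. w i) = b"
    and "((\<Sum>i\<in>A. real i * u i) + (\<Sum>i\<in>B. real i * v i)) / real g - (\<Sum>i\<in>S. part_size w i) = e"
  shows "\<theta> < b \<or> \<theta> < b + e"
proof -
  have "\<theta> < lattice_exponent g A B S u v w (part_size w)"
    using assms by (simp add: all_exceed_def exceeds_def)
  then show ?thesis unfolding lattice_exponent_def assms(3,4) max_def by (simp split: if_splits)
qed

lemma all_exceed_linear:
  assumes "all_exceed \<theta> lam u v w"
  shows "0 \<le> u 0" "0 \<le> u 1" "0 \<le> u 2" "0 \<le> u 3" "0 \<le> u 4" "0 \<le> u 5" "0 \<le> u 6"
    "0 \<le> v 0" "0 \<le> v 1" "0 \<le> v 2" "0 \<le> v 3" "0 \<le> v 4" "0 \<le> v 5" "0 \<le> v 6"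
    "0 \<le> w 0" "0 \<le> w 1" "0 \<le> w 2" "0 \<le> w 3" "0 \<le> w 4" "0 \<le> w 5" "0 \<le> w 6"
    "6 * u 6 \<le> u 0" "6 * v 6 \<le> v 0" "6 * w 6 \<le> w 0"
    "u 1 + 2 * u 2 + 3 * u 3 + 4 * u 4 + 5 * u 5 + u 0 = 1"
    "v 1 + 2 * v 2 + 3 * v 3 + 4 * v 4 + 5 * v 5 + v 0 = 1"
    "w 1 + 2 * w 2 + 3 * w 3 + 4 * w 4 + 5 * w 5 + w 0 = 1"
    "u 1 + u 2 + u 3 + u 4 + u 5 + u 6 + v 1 + v 2 + v 3 + v 4 + v 5 + v 6
      + w 1 + w 2 + w 3 + w 4 + w 5 + w 6 \<le> lam"
    "\<theta> < u 1 + u 2 + u 3 + u 4 + u 5 + u 6 + v 1 + v 2 + v 3 + v 4 + v 5 + v 6"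
    "\<theta> < u 1 + u 2 + u 3 + u 4 + u 5 + u 6 + w 1 + w 2 + w 3 + w 4 + w 5 + w 6"
    "\<theta> < v 1 + v 2 + v 3 + v 4 + v 5 + v 6 + w 1 + w 2 + w 3 + w 4 + w 5 + w 6"
proof -
  \<comment> \<open>The trivial bound: two numbers are fixed completely and nothing is left for the
    lattice.\<close>
  have *: "\<theta> < (\<Sum>i\<in>{1..6}. x i) + (\<Sum>i\<in>{1..6}. y i)" if "all_exceed \<theta> lam x y z" for x y z
    using all_exceed_lattice[OF that, of 1 "{}" "{}" "{}"] by (simp add: admissible_def)
  note 1 = *[OF all_exceed_perms(1)[OF assms]] *[OF all_exceed_perms(2)[OF assms]] *[OF all_exceed_perms(4)[OF assms]]
  show "0 \<le> u 0" "0 \<le> u 1" "0 \<le> u 2" "0 \<le> u 3" "0 \<le> u 4" "0 \<le> u 5" "0 \<le> u 6"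
    "0 \<le> v 0" "0 \<le> v 1" "0 \<le> v 2" "0 \<le> v 3" "0 \<le> v 4" "0 \<le> v 5" "0 \<le> v 6"
    "0 \<le> w 0" "0 \<le> w 1" "0 \<le> w 2" "0 \<le> w 3" "0 \<le> w 4" "0 \<le> w 5" "0 \<le> w 6"
    "6 * u 6 \<le> u 0" "6 * v 6 \<le> v 0" "6 * w 6 \<le> w 0"
    "u 1 + 2 * u 2 + 3 * u 3 + 4 * u 4 + 5 * u 5 + u 0 = 1"
    "v 1 + 2 * v 2 + 3 * v 3 + 4 * v 4 + 5 * v 5 + v 0 = 1"
    "w 1 + 2 * w 2 + 3 * w 3 + 4 * w 4 + 5 * w 5 + w 0 = 1"
    using assms unfolding all_exceed_def profile_def part_size_def interval_expansions by simp_all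
  show "u 1 + u 2 + u 3 + u 4 + u 5 + u 6 + v 1 + v 2 + v 3 + v 4 + v 5 + v 6
      + w 1 + w 2 + w 3 + w 4 + w 5 + w 6 \<le> lam"
    using assms unfolding all_exceed_def interval_expansions by simp
  show "\<theta> < u 1 + u 2 + u 3 + u 4 + u 5 + u 6 + v 1 + v 2 + v 3 + v 4 + v 5 + v 6"
    "\<theta> < u 1 + u 2 + u 3 + u 4 + u 5 + u 6 + w 1 + w 2 + w 3 + w 4 + w 5 + w 6"
    "\<theta> < v 1 + v 2 + v 3 + v 4 + v 5 + v 6 + w 1 + w 2 + w 3 + w 4 + w 5 + w 6"
    using 1 unfolding interval_expansions by simp_all
qed

lemmas expansion_simps = admissible_def part_size_def interval_expansions insert_Diff_if

(* Each step excludes one alternative of a lattice bound by linear programming from the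
   inequalities found so far, in all six orders of the profiles.  The choice of the 14 bounds comes
   from a computer search. *)
lemma not_all_exceed:
  assumes "all_exceed \<theta> lam u v w" and lam: "9 / 11 \<le> lam" "lam \<le> 2" and \<theta>: "\<theta> = (23 * lam + 3) / 40"
  shows False
proof -
  \<comment> \<open>The size equation for \<open>w\<close> turns the second alternative into
    \<open>\<theta> < lam - 1\<close>, which fails for \<open>lam \<le> 2\<close>.\<close>
  have s1: "\<theta> < u 2 + u 3 + u 4 + u 5 + u 6 + v 2 + v 3 + v 4 + v 5 + v 6 + w 2 + w 3 + w 4 + w 5
      + w 6" if c: "all_exceed \<theta> lam u v w" for u v w
  proof -
    have "\<theta> < u 2 + u 3 + u 4 + u 5 + u 6 + v 2 + v 3 + v 4 + v 5 + v 6 + w 2 + w 3 + w 4 + w 5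
        + w 6 \<or> \<theta> < u 2 + u 3 + u 4 + u 5 + u 6 + v 2 + v 3 + v 4 + v 5 + v 6 + w 2 + w 3 + w 4
        + w 5 + w 6 + (u 1 + v 1 - 2 * w 2 - 3 * w 3 - 4 * w 4 - 5 * w 5 - w 0)"
      by (rule all_exceed_lattice[OF c, of 1 "{1}" "{1}" "{2, 3, 4, 5, 6}"])
        (simp_all add: expansion_simps field_simps del: One_nat_def)
    then show ?thesis
      using all_exceed_linear(27-28)[OF c] lam(2) \<theta>
      by argo
  qed
  have s2: "\<theta> < u 1 + u 3 + u 5 + u 6 + v 1 + v 3 + v 5 + v 6 + w 2 + w 3 + w 4 + w 5 + w 6" if c:
      "all_exceed \<theta> lam u v w" for u v w
  proof -
    have "\<theta> < u 1 + u 3 + u 5 + u 6 + v 1 + v 3 + v 5 + v 6 + w 2 + w 3 + w 4 + w 5 + w 6 \<or> \<theta> <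
        u 1 + u 3 + u 5 + u 6 + v 1 + v 3 + v 5 + v 6 + w 2 + w 3 + w 4 + w 5 + w 6 + (u 2
        + 2 * u 4 + v 2 + 2 * v 4 - 2 * w 2 - 3 * w 3 - 4 * w 4 - 5 * w 5 - w 0)"
      by (rule all_exceed_lattice[OF c, of 2 "{2, 4}" "{2, 4}" "{2, 3, 4, 5, 6}"])
        (simp_all add: expansion_simps field_simps del: One_nat_def)
    then show ?thesis
      using all_exceed_linear(1,4-6,8,11-13,16,22-23,25-29)[OF c] s1[OF c] \<theta>
      by argo
  qed
  have s3: "\<theta> < u 1 + u 2 + u 4 + u 5 + u 6 + v 1 + v 2 + v 4 + v 5 + v 6 + w 3 + w 4 + w 5 + w 6"
      if c: "all_exceed \<theta> lam u v w" for u v w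
  proof -
    have "\<theta> < u 1 + u 2 + u 4 + u 5 + u 6 + v 1 + v 2 + v 4 + v 5 + v 6 + w 3 + w 4 + w 5 + w 6 \<or>
        \<theta> < u 1 + u 2 + u 4 + u 5 + u 6 + v 1 + v 2 + v 4 + v 5 + v 6 + w 3 + w 4 + w 5 + w 6
        + (u 3 + v 3 - 3 * w 3 - 4 * w 4 - 5 * w 5 - w 0)"
      by (rule all_exceed_lattice[OF c, of 3 "{3}" "{3}" "{3, 4, 5, 6}"])
        (simp_all add: expansion_simps field_simps del: One_nat_def)
    then show ?thesis
      using all_exceed_linear(1,5-6,8,12-13,15-16,18-20,22-28)[OF c] s1[OF c]
          s2[OF all_exceed_perms(2)[OF c]] s2[OF all_exceed_perms(4)[OF c]] \<theta>
      by argo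
  qed
  have s4: "\<theta> < u 2 + u 3 + u 4 + u 5 + u 6 + v 2 + v 3 + v 4 + v 5 + v 6 + w 3 + w 4 + w 5 + w 6"
      if c: "all_exceed \<theta> lam u v w" for u v w
  proof -
    have "\<theta> < u 2 + u 3 + u 4 + u 5 + u 6 + v 2 + v 3 + v 4 + v 5 + v 6 + w 3 + w 4 + w 5 + w 6 \<or>
        \<theta> < u 2 + u 3 + u 4 + u 5 + u 6 + v 2 + v 3 + v 4 + v 5 + v 6 + w 3 + w 4 + w 5 + w 6
        + (u 1 + v 1 - 3 * w 3 - 4 * w 4 - 5 * w 5 - w 0)"
      by (rule all_exceed_lattice[OF c, of 1 "{1}" "{1}" "{3, 4, 5, 6}"])
        (simp_all add: expansion_simps field_simps del: One_nat_def)
    then show ?thesis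
      using all_exceed_linear(1,5-6,8,12-13,15-16,18-20,22-28)[OF c] s1[OF c]
          s2[OF all_exceed_perms(2)[OF c]] s2[OF all_exceed_perms(4)[OF c]] \<theta>
      by argo
  qed
  \<comment> \<open>The only choice that treats the first two numbers differently: squares are taken
    from part 2 of one and from part 4 of the other, a fourth power being read as a square.\<close>
  have s5: "\<theta> < u 1 + u 3 + u 4 + u 5 + u 6 + v 1 + v 2 + v 3 + v 5 + v 6 + w 3 + w 4 + w 5 + w 6"
      if c: "all_exceed \<theta> lam u v w" for u v w
  proof -
    have "\<theta> < u 1 + u 3 + u 4 + u 5 + u 6 + v 1 + v 2 + v 3 + v 5 + v 6 + w 3 + w 4 + w 5 + w 6 \<or>
        \<theta> < u 1 + u 3 + u 4 + u 5 + u 6 + v 1 + v 2 + v 3 + v 5 + v 6 + w 3 + w 4 + w 5 + w 6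
        + (u 2 + 2 * v 4 - 3 * w 3 - 4 * w 4 - 5 * w 5 - w 0)"
      by (rule all_exceed_lattice[OF c, of 2 "{2}" "{4}" "{3, 4, 5, 6}"])
        (simp_all add: expansion_simps field_simps del: One_nat_def)
    then show ?thesis
      using all_exceed_linear(1,3,5-6,8-9,11,13,15,19-20,22-28)[OF c] lam(1)
          s2[OF all_exceed_perms(2)[OF c]] s4[OF c] \<theta>
      by argo
  qed
  have s6: "\<theta> < u 1 + u 2 + u 4 + u 5 + u 6 + v 1 + v 2 + v 4 + v 5 + v 6 + w 4 + w 5 + w 6" if c:
      "all_exceed \<theta> lam u v w" for u v w
  proof -
    have "\<theta> < u 1 + u 2 + u 4 + u 5 + u 6 + v 1 + v 2 + v 4 + v 5 + v 6 + w 4 + w 5 + w 6 \<or> \<theta> <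
        u 1 + u 2 + u 4 + u 5 + u 6 + v 1 + v 2 + v 4 + v 5 + v 6 + w 4 + w 5 + w 6 + (u 3 + v 3
        - 4 * w 4 - 5 * w 5 - w 0)"
      by (rule all_exceed_lattice[OF c, of 3 "{3}" "{3}" "{4, 5, 6}"])
        (simp_all add: expansion_simps field_simps del: One_nat_def)
    then show ?thesis
      using all_exceed_linear(1,8,15,19-20,22-28)[OF c] lam(1) s2[OF c]
          s2[OF all_exceed_perms(2)[OF c]] s2[OF all_exceed_perms(4)[OF c]]
          s3[OF all_exceed_perms(2)[OF c]] s3[OF all_exceed_perms(4)[OF c]] s4[OF c] \<theta>
      by argo
  qed
  have s7: "\<theta> < u 1 + u 2 + u 3 + u 4 + u 6 + v 1 + v 2 + v 3 + v 4 + v 6 + w 4 + w 5 + w 6" if c: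
      "all_exceed \<theta> lam u v w" for u v w
  proof -
    have "\<theta> < u 1 + u 2 + u 3 + u 4 + u 6 + v 1 + v 2 + v 3 + v 4 + v 6 + w 4 + w 5 + w 6 \<or> \<theta> <
        u 1 + u 2 + u 3 + u 4 + u 6 + v 1 + v 2 + v 3 + v 4 + v 6 + w 4 + w 5 + w 6 + (u 5 + v 5
        - 4 * w 4 - 5 * w 5 - w 0)"
      by (rule all_exceed_lattice[OF c, of 5 "{5}" "{5}" "{4, 5, 6}"])
        (simp_all add: expansion_simps field_simps del: One_nat_def)
    then show ?thesis
      using all_exceed_linear(1,4,8-9,11,13,15-16,19-20,22-28)[OF c] s4[OF c] s5[OF c]
          s5[OF all_exceed_perms(5)[OF c]] s6[OF all_exceed_perms(2)[OF c]]
          s6[OF all_exceed_perms(4)[OF c]] \<theta>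
      by argo
  qed
  have s8: "\<theta> < u 2 + u 3 + u 4 + u 5 + u 6 + v 2 + v 3 + v 4 + v 5 + v 6 + w 4 + w 5 + w 6" if c:
      "all_exceed \<theta> lam u v w" for u v w
  proof -
    have "\<theta> < u 2 + u 3 + u 4 + u 5 + u 6 + v 2 + v 3 + v 4 + v 5 + v 6 + w 4 + w 5 + w 6 \<or> \<theta> <
        u 2 + u 3 + u 4 + u 5 + u 6 + v 2 + v 3 + v 4 + v 5 + v 6 + w 4 + w 5 + w 6 + (u 1 + v 1
        - 4 * w 4 - 5 * w 5 - w 0)"
      by (rule all_exceed_lattice[OF c, of 1 "{1}" "{1}" "{4, 5, 6}"])
        (simp_all add: expansion_simps field_simps del: One_nat_def)
    then show ?thesis
      using all_exceed_linear(1,4,8-9,11,13,15-16,19-20,22-28)[OF c] s4[OF c] s5[OF c]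
          s5[OF all_exceed_perms(5)[OF c]] s6[OF all_exceed_perms(2)[OF c]]
          s6[OF all_exceed_perms(4)[OF c]] \<theta>
      by argo
  qed
  have s9: "\<theta> < u 1 + u 2 + u 3 + u 5 + u 6 + v 1 + v 2 + v 3 + v 5 + v 6 + w 4 + w 5 + w 6" if c:
      "all_exceed \<theta> lam u v w" for u v w
  proof -
    have "\<theta> < u 1 + u 2 + u 3 + u 5 + u 6 + v 1 + v 2 + v 3 + v 5 + v 6 + w 4 + w 5 + w 6 \<or> \<theta> <
        u 1 + u 2 + u 3 + u 5 + u 6 + v 1 + v 2 + v 3 + v 5 + v 6 + w 4 + w 5 + w 6 + (u 4 + v 4
        - 4 * w 4 - 5 * w 5 - w 0)"
      by (rule all_exceed_lattice[OF c, of 4 "{4}" "{4}" "{4, 5, 6}"])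
        (simp_all add: expansion_simps field_simps del: One_nat_def)
    then show ?thesis
      using all_exceed_linear(1,4-6,8-9,11-12,15,17,19-20,22-28)[OF c]
          s5[OF all_exceed_perms(6)[OF c]] s6[OF all_exceed_perms(2)[OF c]] s8[OF c] \<theta>
      by argo
  qed
  have s10: "\<theta> < u 2 + u 3 + u 4 + u 5 + u 6 + v 2 + v 3 + v 4 + v 5 + v 6 + w 5 + w 6" if c:
      "all_exceed \<theta> lam u v w" for u v w
  proof -
    have "\<theta> < u 2 + u 3 + u 4 + u 5 + u 6 + v 2 + v 3 + v 4 + v 5 + v 6 + w 5 + w 6 \<or> \<theta> < u 2
        + u 3 + u 4 + u 5 + u 6 + v 2 + v 3 + v 4 + v 5 + v 6 + w 5 + w 6 + (u 1 + v 1 - 5 * w 5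
        - w 0)"
      by (rule all_exceed_lattice[OF c, of 1 "{1}" "{1}" "{5, 6}"])
        (simp_all add: expansion_simps field_simps del: One_nat_def)
    then show ?thesis
      using all_exceed_linear(1,8,11,15-16,18,20,22-28)[OF c] s2[OF all_exceed_perms(4)[OF c]]
          s5[OF all_exceed_perms(2)[OF c]] s6[OF all_exceed_perms(2)[OF c]]
          s6[OF all_exceed_perms(4)[OF c]] s7[OF c] s8[OF c] s9[OF all_exceed_perms(2)[OF c]]
          s9[OF all_exceed_perms(4)[OF c]] \<theta>
      by argo
  qed
  have s11: "\<theta> < u 1 + u 3 + u 5 + u 6 + v 1 + v 3 + v 5 + v 6 + w 5 + w 6" if c: "all_exceed \<theta>
      lam u v w" for u v w
  proof -
    have "\<theta> < u 1 + u 3 + u 5 + u 6 + v 1 + v 3 + v 5 + v 6 + w 5 + w 6 \<or> \<theta> < u 1 + u 3 + u 5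
        + u 6 + v 1 + v 3 + v 5 + v 6 + w 5 + w 6 + (u 2 + 2 * u 4 + v 2 + 2 * v 4 - 5 * w 5
        - w 0)"
      by (rule all_exceed_lattice[OF c, of 2 "{2, 4}" "{2, 4}" "{5, 6}"])
        (simp_all add: expansion_simps field_simps del: One_nat_def)
    then show ?thesis
      using all_exceed_linear(15-16,22-29)[OF c] s2[OF c] s6[OF c]
          s6[OF all_exceed_perms(2)[OF c]] s6[OF all_exceed_perms(4)[OF c]] s7[OF c] s9[OF c]
          s9[OF all_exceed_perms(2)[OF c]] s9[OF all_exceed_perms(4)[OF c]] s10[OF c] \<theta>
      by argo
  qed
  have s12: "\<theta> < u 1 + u 2 + u 3 + u 4 + u 6 + v 1 + v 2 + v 3 + v 4 + v 6 + w 2 + w 3 + w 4" if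
      c: "all_exceed \<theta> lam u v w" for u v w
  proof -
    have "\<theta> < u 1 + u 2 + u 3 + u 4 + u 6 + v 1 + v 2 + v 3 + v 4 + v 6 + w 2 + w 3 + w 4 \<or> \<theta> <
        u 1 + u 2 + u 3 + u 4 + u 6 + v 1 + v 2 + v 3 + v 4 + v 6 + w 2 + w 3 + w 4 + (u 5 + v 5
        - 2 * w 2 - 3 * w 3 - 4 * w 4)"
      by (rule all_exceed_lattice[OF c, of 5 "{5}" "{5}" "{2, 3, 4}"])
        (simp_all add: expansion_simps field_simps del: One_nat_def)
    then show ?thesis
      using all_exceed_linear(5,8-9,12,17-19,22-28,30-31)[OF c] s2[OF c] s7[OF c]
          s7[OF all_exceed_perms(2)[OF c]] s7[OF all_exceed_perms(4)[OF c]]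
          s10[OF all_exceed_perms(2)[OF c]] s10[OF all_exceed_perms(4)[OF c]] \<theta>
      by argo
  qed
  have s13: "\<theta> < u 1 + u 3 + u 5 + u 6 + v 1 + v 3 + v 5 + v 6 + w 2 + w 3 + w 4" if c:
      "all_exceed \<theta> lam u v w" for u v w
  proof -
    have "\<theta> < u 1 + u 3 + u 5 + u 6 + v 1 + v 3 + v 5 + v 6 + w 2 + w 3 + w 4 \<or> \<theta> < u 1 + u 3
        + u 5 + u 6 + v 1 + v 3 + v 5 + v 6 + w 2 + w 3 + w 4 + (u 2 + 2 * u 4 + v 2 + 2 * v 4
        - 2 * w 2 - 3 * w 3 - 4 * w 4)"
      by (rule all_exceed_lattice[OF c, of 2 "{2, 4}" "{2, 4}" "{2, 3, 4}"])
        (simp_all add: expansion_simps field_simps del: One_nat_def)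
    then show ?thesis
      using all_exceed_linear(1,5,12,16,18-19,22-28)[OF c] lam(1) s7[OF all_exceed_perms(2)[OF c]]
          s7[OF all_exceed_perms(4)[OF c]] s10[OF all_exceed_perms(2)[OF c]]
          s10[OF all_exceed_perms(4)[OF c]] s11[OF all_exceed_perms(2)[OF c]]
          s11[OF all_exceed_perms(4)[OF c]] s12[OF c] s12[OF all_exceed_perms(2)[OF c]] \<theta>
      by argo
  qed
  \<comment> \<open>The roles of the alternatives are exchanged: here the bound without the lattice
    term is refuted, and the one that contains it survives.\<close>
  have s14: "\<theta> < u 1 + u 2 + u 4 + u 5 + u 6 + v 1 + v 2 + v 4 + v 5 + v 6 + w 2 + w 4 + u 3 + v 3
      - 2 * w 2 - 4 * w 4" if c: "all_exceed \<theta> lam u v w" for u v w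
  proof -
    have "\<theta> < u 1 + u 2 + u 4 + u 5 + u 6 + v 1 + v 2 + v 4 + v 5 + v 6 + w 2 + w 4 \<or> \<theta> < u 1
        + u 2 + u 4 + u 5 + u 6 + v 1 + v 2 + v 4 + v 5 + v 6 + w 2 + w 4 + (u 3 + v 3 - 2 * w 2
        - 4 * w 4)"
      by (rule all_exceed_lattice[OF c, of 3 "{3}" "{3}" "{2, 4}"])
        (simp_all add: expansion_simps field_simps del: One_nat_def)
    then show ?thesis
      using all_exceed_linear(4-5,8,12,15,17,19,22-28,30-31)[OF c]
          s3[OF all_exceed_perms(2)[OF c]] s7[OF c] s10[OF c] s13[OF c]
          s13[OF all_exceed_perms(2)[OF c]] s13[OF all_exceed_perms(4)[OF c]] \<theta>
      by argo
  qed
  \<comment> \<open>\<open>s14\<close> enters three times, once with each number supplying the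
    modulus.\<close>
  show False
    using all_exceed_linear(3,5-6,10,12,17,19-20,22-28)[OF assms(1)] s6[OF assms(1)]
        s10[OF assms(1)] s10[OF all_exceed_perms(2)[OF assms(1)]] s12[OF assms(1)]
        s12[OF all_exceed_perms(2)[OF assms(1)]] s14[OF assms(1)]
        s14[OF all_exceed_perms(2)[OF assms(1)]] s14[OF all_exceed_perms(4)[OF assms(1)]] \<theta>
    by argo
qed

text \<open>Adding the three trivial bounds gives \<open>3 * \<theta> < 2 * lam\<close>, while (23
  lam + 3) / 40 is at least 2 lam / 3 precisely for lam up to 9 / 11.\<close>

lemma not_all_exceed_small:
  assumes "all_exceed \<theta> lam u v w" and "lam \<le> 9 / 11" "\<theta> = (23 * lam + 3) / 40"
  shows False
  using all_exceed_linear(28-31)[OF assms(1)] assms(2,3) by argo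

text \<open>The second alternative amounts to \<open>\<theta> < lam - 1\<close>. In the first, the
  radical exponents of index at least 2 have a sum s above \<theta>. The size equations leave at
  most 3 - 2 s for the first parts, so all exponents together are at most 3 - s, whereas the three
  trivial bounds force more than 3 \<theta> / 2. Hence \<theta> < s < 3 - 3 \<theta> / 2, which
  means \<theta> < 6 / 5.\<close>

lemma not_all_exceed_large:
  assumes "all_exceed \<theta> lam u v w" and "6 / 5 \<le> \<theta>" "lam - 1 \<le> \<theta>"
  shows False
proof -
  have "\<theta> < u 2 + u 3 + u 4 + u 5 + u 6 + v 2 + v 3 + v 4 + v 5 + v 6 + w 2 + w 3 + w 4 + w 5 + w 6 \<or>
    \<theta> < u 2 + u 3 + u 4 + u 5 + u 6 + v 2 + v 3 + v 4 + v 5 + v 6 + w 2 + w 3 + w 4 + w 5 + w 6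
      + (u 1 + v 1 - 2 * w 2 - 3 * w 3 - 4 * w 4 - 5 * w 5 - w 0)"
    by (rule all_exceed_lattice[OF assms(1), of 1 "{1}" "{1}" "{2, 3, 4, 5, 6}"])
      (simp_all add: expansion_simps field_simps del: One_nat_def)
  then show False
    using all_exceed_linear[OF assms(1)] assms(2,3) by argo
qed

section \<open>Counting triples\<close>

text \<open>The order \<open>a \<le> b\<close> makes \<open>b\<close> larger than
  \<open>Y / 4\<close>, so that only \<open>a\<close> can be much smaller than \<open>Y\<close>. The
  radical is compared with a power of \<open>Y\<close> instead of \<open>c\<close>, so that
  logarithms to base \<open>Y\<close> add up to at most \<open>lam\<close>.\<close>

definition dyadic_triples :: "real \<Rightarrow> real \<Rightarrow> (nat \<times> nat \<times> nat) set" where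
  "dyadic_triples lam Y = {(a, b, c). 0 < a \<and> a \<le> b \<and> a + b = c \<and> Y / 2 < real c \<and> real c \<le> Y \<and>
     coprime a b \<and> real (rad (a * b * c)) < Y powr lam}"

(* The sizes are normalised to total exponent 1 by enlarging the last one.  For the smallest of the
   three numbers this is paid for by the thinness parameter of card_fibre_le; for the other two the
   loss is absorbed by \<eta>. *)
definition exponent_profile :: "real \<Rightarrow> nat \<Rightarrow> nat \<Rightarrow> real" where
  "exponent_profile Y n i = (if i = 0 then log Y (part 6 n) + 1 - log Y n
     else if i \<le> 6 then log Y (rad (part i n)) else 0)"

lemma log_nat_bounds:
  assumes "1 < Y" "0 < n" "real n \<le> Y"
  shows "0 \<le> log Y (real n)" "log Y (real n) \<le> 1"
  using assms by (auto simp: zero_le_log_cancel_iff)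

lemma log_block:
  assumes "1 < Y"
  shows "log Y (real (block I n)) = (\<Sum>i\<in>I. log Y (real (part i n)))"
proof (cases "finite I")
  case True
  have "ln (real (block I n)) = (\<Sum>i\<in>I. ln (real (part i n)))"
    unfolding block_def of_nat_prod using True by (intro ln_prod) auto
  then show ?thesis by (simp add: log_def sum_divide_distrib)
qed (simp add: block_def)

lemma log_part_eq:
  assumes "i < 6"
  shows "log Y (real (part i n)) = real i * log Y (real (rad (part i n)))"
proof -
  have "log Y (real (part i n)) = log Y (real (rad (part i n)) ^ i)"
    using part_eq_rad_power[OF assms, of n] by (metis of_nat_power)
  also have "\<dots> = real i * log Y (real (rad (part i n)))" by (simp add: log_nat_power)
  finally show ?thesis .
qed

lemma part_size_exponent_profile:
  assumes "i \<in> {1..6}"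
  shows "part_size (exponent_profile Y n) i = log Y (real (part i n)) + (if i = 6 then 1 - log Y n else 0)"
  using assms log_part_eq[of i Y n] by (auto simp: part_size_def exponent_profile_def)

text \<open>Only the 6-full part can absorb the missing size: below index 6 a size is tied to its
  radical, whereas enlarging \<open>u 0\<close> keeps \<open>6 * u 6 \<le> u 0\<close> and changes
  no radical exponent.\<close>

lemma profile_exponent_profile:
  assumes Y: "1 < Y" and n: "0 < n" "real n \<le> Y"
  shows "profile (exponent_profile Y n)"
  unfolding profile_def
proof (intro conjI allI)
  have part: "0 \<le> log Y (real (part i n))" "0 \<le> log Y (real (rad (part i n)))" for i
    using Y by (simp_all add: zero_le_log_cancel_iff Suc_leI)
  show "0 \<le> exponent_profile Y n i" for i
    using part(1)[of 6] part(2)[of i] log_nat_bounds(2)[OF Y n] unfolding exponent_profile_def by auto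
  have "6 * log Y (real (rad (part 6 n))) = log Y (real (rad (part 6 n)) ^ 6)"
    by (simp add: log_nat_power)
  also have "\<dots> \<le> log Y (real (part 6 n))"
    using rad_power_le_part[of n] Y by (subst log_le_cancel_iff) (auto simp flip: of_nat_power)
  finally show "6 * exponent_profile Y n 6 \<le> exponent_profile Y n 0"
    using log_nat_bounds(2)[OF Y n] by (simp add: exponent_profile_def)
  have "(\<Sum>i\<in>{1..6}. part_size (exponent_profile Y n) i)
      = (\<Sum>i\<in>{1..6}. log Y (real (part i n)) + (if i = 6 then 1 - log Y n else 0))"
    using part_size_exponent_profile by (intro sum.cong) auto
  also have "\<dots> = log Y (real (block {1..6} n)) + (1 - log Y n)"
    unfolding log_block[OF Y] by (simp add: sum.distrib)
  also have "\<dots> = 1" using block_all[OF n(1)] by simp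
  finally show "(\<Sum>i\<in>{1..6}. part_size (exponent_profile Y n) i) = 1" .
qed

lemma sum_exponent_profile:
  assumes Y: "1 < Y" and n: "0 < n"
  shows "(\<Sum>i\<in>{1..6}. exponent_profile Y n i) = log Y (real (rad n))"
proof -
  have "(\<Sum>i\<in>{1..6}. exponent_profile Y n i) = (\<Sum>i\<in>{1..6}. ln (real (rad (part i n)))) / ln Y"
    unfolding sum_divide_distrib by (intro sum.cong) (auto simp: exponent_profile_def log_def)
  also have "(\<Sum>i\<in>{1..6}. ln (real (rad (part i n)))) = ln (real (rad n))"
    unfolding rad_classes[OF n] of_nat_prod by (intro ln_prod [symmetric]) auto
  finally show ?thesis by (simp add: log_def)
qed

lemma close_to_exponent_profile:
  assumes Y: "1 < Y" and m: "0 < m" "real m \<le> Y"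
    and d: "\<And>i. i \<in> {1..6} \<Longrightarrow> \<bar>log Y (real (rad (part i m))) - log Y (real (rad (part i n)))\<bar> \<le> \<eta>"
  shows "close_to \<eta> Y (exponent_profile Y n) m"
  unfolding close_to_def
proof (intro conjI ballI)
  fix i :: nat assume i: "i \<in> {1..6}"
  have eq: "real (rad (part i m)) = Y powr log Y (real (rad (part i m)))" using Y by simp
  show "Y powr (exponent_profile Y n i - \<eta>) \<le> real (rad (part i m))"
    by (subst eq, rule powr_mono) (use d[OF i] i Y in \<open>auto simp: exponent_profile_def\<close>)
  show "real (rad (part i m)) \<le> Y powr (exponent_profile Y n i + \<eta>)"
    by (subst eq, rule powr_mono) (use d[OF i] i Y in \<open>auto simp: exponent_profile_def\<close>)
qed (use m in auto)

lemma log_block_diff: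
  assumes Y: "1 < Y" and S: "S \<subseteq> {1..6}" and \<eta>: "0 < \<eta>"
    and d: "\<And>i. i \<in> {1..6} \<Longrightarrow> \<bar>log Y (real (part i m)) - log Y (real (part i n))\<bar> \<le> \<eta>"
  shows "\<bar>log Y (real (block S m)) - log Y (real (block S n))\<bar> \<le> 6 * \<eta>"
proof -
  have "\<bar>log Y (real (block S m)) - log Y (real (block S n))\<bar>
      = \<bar>\<Sum>i\<in>S. log Y (real (part i m)) - log Y (real (part i n))\<bar>"
    unfolding log_block[OF Y] by (simp add: sum_subtractf)
  also have "\<dots> \<le> (\<Sum>i\<in>S. \<bar>log Y (real (part i m)) - log Y (real (part i n))\<bar>)" by (rule sum_abs)
  also have "\<dots> \<le> (\<Sum>i\<in>S. \<eta>)" using d S by (intro sum_mono) auto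
  also have "\<dots> = real (card S) * \<eta>" by simp
  also have "\<dots> \<le> 6 * \<eta>"
    using card_mono[OF _ S] \<eta> by (intro mult_right_mono) auto
  finally show ?thesis .
qed

text \<open>The normalised sizes over \<open>S\<close> exceed the true ones by at most
  \<open>1 - log Y n\<close>, namely when \<open>6 \<in> S\<close>, and the assumed smallness of
  \<open>\<tau>\<close> compensates exactly this. Passing from \<open>n\<close> to another number
  \<open>m\<close> of the same box costs \<open>6 * \<eta>\<close>, the difference between 14 and
  20.\<close>

lemma thinness_le_block:
  assumes Y: "1 < Y" and S: "S \<subseteq> {1..6}" and \<eta>: "0 < \<eta>" and n: "0 < n" "real n \<le> Y"
    and d: "\<And>i. i \<in> {1..6} \<Longrightarrow> \<bar>log Y (real (part i m)) - log Y (real (part i n))\<bar> \<le> \<eta>"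
    and \<tau>: "\<tau> \<le> Y powr (14 * \<eta> - (1 - log Y (real n)))"
  shows "\<tau> \<le> Y powr (20 * \<eta> - (\<Sum>i\<in>S. part_size (exponent_profile Y n) i)) * real (block S m)"
proof -
  have finS: "finite S" using S finite_subset by blast
  have "(\<Sum>i\<in>S. part_size (exponent_profile Y n) i)
      = (\<Sum>i\<in>S. log Y (real (part i n)) + (if i = 6 then 1 - log Y n else 0))"
    using part_size_exponent_profile S by (intro sum.cong) auto
  also have "\<dots> = log Y (real (block S n)) + (if 6 \<in> S then 1 - log Y n else 0)"
    unfolding log_block[OF Y] using finS by (simp add: sum.distrib)
  also have "\<dots> \<le> log Y (real (block S n)) + (1 - log Y n)"
    using log_nat_bounds(2)[OF Y n] by simp
  finally have "14 * \<eta> - (1 - log Y (real n))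
      \<le> 20 * \<eta> - (\<Sum>i\<in>S. part_size (exponent_profile Y n) i) + log Y (real (block S m))"
    using log_block_diff[OF Y S \<eta> d] by linarith
  then have "Y powr (14 * \<eta> - (1 - log Y (real n)))
      \<le> Y powr (20 * \<eta> - (\<Sum>i\<in>S. part_size (exponent_profile Y n) i) + log Y (real (block S m)))"
    using Y by (intro powr_mono) auto
  then show ?thesis using \<tau> Y by (simp add: powr_add)
qed

lemma dyadic_triplesD:
  assumes "(a, b, c) \<in> dyadic_triples lam Y"
  shows "0 < a" "0 < b" "0 < c" "a \<le> b" "c = a + b" "real a \<le> Y" "real b \<le> Y" "real c \<le> Y"
    "Y / 2 < real c" "Y / 4 < real b" "coprime a b" "coprime a c" "coprime b c"
    "real (rad a) * real (rad b) * real (rad c) < Y powr lam"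
proof -
  show *: "0 < a" "a \<le> b" "c = a + b" "real c \<le> Y" "Y / 2 < real c" "coprime a b"
    using assms by (auto simp: dyadic_triples_def)
  then show "0 < b" "0 < c" "real a \<le> Y" "real b \<le> Y" by auto
  show "Y / 4 < real b" using * by simp
  have "gcd a (a + b) = 1" "gcd b (b + a) = 1"
    unfolding gcd_add2 using *(6) by (simp_all only: coprime_iff_gcd_eq_1 gcd.commute[of b a])
  then have "coprime a (a + b)" "coprime b (a + b)"
    unfolding coprime_iff_gcd_eq_1 add.commute[of b a] .
  then show c: "coprime a c" "coprime b c" unfolding *(3) .
  have ab: "0 < a * b" "0 < b" and c0: "0 < c" using *(1-3) by simp_all
  have "coprime (a * b) c" using c by (simp only: coprime_mult_left_iff)
  with ab(1) c0 have "rad (a * b * c) = rad (a * b) * rad c" by (rule rad_mult_coprime)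
  also have "rad (a * b) = rad a * rad b"
    by (rule rad_mult_coprime[OF *(1) ab(2) *(6)])
  finally have "rad (a * b * c) = rad a * rad b * rad c" .
  moreover have "real (rad (a * b * c)) < Y powr lam" using assms unfolding dyadic_triples_def by blast
  ultimately show "real (rad a) * real (rad b) * real (rad c) < Y powr lam"
    by (simp only: of_nat_mult)
qed


text \<open>Any triple of the box provides the three profiles, and since they do not all exceed
  \<open>\<theta>\<close>, one of the numbers works as the source of the modulus. If that is b or c,
  which are within a factor 4 of Y, the normalisation costs at most \<open>2 * \<eta>\<close> and no
  thinness is required. If it is a, then c / b = 1 + a / b confines the pairs (b, c) to a cone whose
  thinness matches the smallness of a.\<close>

lemma card_dyadic_fibre_le:
  fixes \<eta> Y C C' \<theta> lam :: real and F :: "(nat \<times> nat \<times> nat) set"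
  assumes \<eta>: "0 < \<eta>" and Y: "1 < Y" "log Y 2 \<le> \<eta>" and C: "1 \<le> C" "1 \<le> C'"
    and count: "\<And>Y R::real. 1 \<le> Y \<Longrightarrow> 0 \<le> R \<Longrightarrow>
           real (card {s::nat. real s \<le> Y \<and> 0 < s \<and> real (rad s) \<le> R}) \<le> C * R * Y powr \<eta>"
    and roots: "\<And>P::nat set. finite P \<Longrightarrow> (\<forall>p\<in>P. prime p) \<Longrightarrow> 125 ^ card P \<le> C' * real (\<Prod>P) powr \<eta>"
    and no: "\<And>u v w. \<not> all_exceed \<theta> lam u v w"
    and F: "finite F" "F \<subseteq> dyadic_triples lam Y"
    and near: "\<And>f s t i. f \<in> {fst, fst \<circ> snd, snd \<circ> snd} \<Longrightarrow> s \<in> F \<Longrightarrow> t \<in> F \<Longrightarrow> i \<in> {1..6} \<Longrightarrow>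
        \<bar>log Y (real (rad (part i (f s)))) - log Y (real (rad (part i (f t))))\<bar> \<le> \<eta> \<and>
        \<bar>log Y (real (part i (f s))) - log Y (real (part i (f t)))\<bar> \<le> \<eta>"
  shows "real (card F) \<le> 2 * C ^ 18 * C' * Y powr (\<theta> + 120 * \<eta>)"
proof (cases "F = {}")
  case True
  then show ?thesis using C by simp
next
  case False
  then obtain t where t: "t \<in> F" by auto
  obtain a b c where tabc: "t = (a, b, c)" by (cases t)
  have abc: "(a, b, c) \<in> dyadic_triples lam Y" using t F tabc by auto
  note D = dyadic_triplesD[OF abc]
  define fa fb fc :: "nat \<times> nat \<times> nat \<Rightarrow> nat" where "fa = fst" and "fb = fst \<circ> snd" and "fc = snd \<circ> snd"
  have ft: "fa t = a" "fb t = b" "fc t = c" by (simp_all add: tabc fa_def fb_def fc_def)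
  have DF: "(fa s, fb s, fc s) \<in> dyadic_triples lam Y" if "s \<in> F" for s
    using F that by (cases s) (auto simp: fa_def fb_def fc_def)
  have nr: "\<bar>log Y (real (rad (part i (f s)))) - log Y (real (rad (part i (f t))))\<bar> \<le> \<eta>"
    "\<bar>log Y (real (part i (f s))) - log Y (real (part i (f t)))\<bar> \<le> \<eta>"
    if "f \<in> {fa, fb, fc}" "s \<in> F" "i \<in> {1..6}" for f s i
    using near[of f s t i] that t by (auto simp: fa_def fb_def fc_def)
  have cl: "close_to \<eta> Y (exponent_profile Y (fa t)) (fa s)" "close_to \<eta> Y (exponent_profile Y (fb t)) (fb s)"
    "close_to \<eta> Y (exponent_profile Y (fc t)) (fc s)" if s: "s \<in> F" for s
  proof -
    show "close_to \<eta> Y (exponent_profile Y (fa t)) (fa s)"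
      by (rule close_to_exponent_profile[OF Y(1) dyadic_triplesD(1,6)[OF DF[OF s]]]) (simp add: nr(1) s)
    show "close_to \<eta> Y (exponent_profile Y (fb t)) (fb s)"
      by (rule close_to_exponent_profile[OF Y(1) dyadic_triplesD(2,7)[OF DF[OF s]]]) (simp add: nr(1) s)
    show "close_to \<eta> Y (exponent_profile Y (fc t)) (fc s)"
      by (rule close_to_exponent_profile[OF Y(1) dyadic_triplesD(3,8)[OF DF[OF s]]]) (simp add: nr(1) s)
  qed
  have cop: "coprime (fa s) (fb s)" "coprime (fa s) (fc s)" "coprime (fb s) (fc s)" if s: "s \<in> F" for s
    using dyadic_triplesD[OF DF[OF s]] by auto
  have sum: "fc s = fa s + fb s" if s: "s \<in> F" for s using dyadic_triplesD[OF DF[OF s]] by auto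
  have eqI: "s = s'" if "s \<in> F" "s' \<in> F" "fa s = fa s'" "fb s = fb s'" for s s'
    using sum[OF that(1)] sum[OF that(2)] that(3,4)
    by (cases s; cases s') (simp add: fa_def fb_def fc_def)
  have inj_ab: "inj_on (\<lambda>s. (fa s, fb s)) F"
    by (rule inj_onI) (simp add: eqI)
  have inj_ac: "inj_on (\<lambda>s. (fa s, fc s)) F"
  proof (rule inj_onI)
    fix s s' assume s: "s \<in> F" "s' \<in> F" "(fa s, fc s) = (fa s', fc s')"
    then have "fb s = fb s'" using sum[OF s(1)] sum[OF s(2)] by simp
    then show "s = s'" using eqI s by simp
  qed
  have inj_bc: "inj_on (\<lambda>s. (fb s, fc s)) F"
  proof (rule inj_onI)
    fix s s' assume s: "s \<in> F" "s' \<in> F" "(fb s, fc s) = (fb s', fc s')"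
    then have "fa s = fa s'" using sum[OF s(1)] sum[OF s(2)] by simp
    then show "s = s'" using eqI s by simp
  qed
  have admD: "g \<in> {1..5}" "A \<subseteq> {1..5}" "B \<subseteq> {1..5}" "S \<subseteq> {1..6}" "i \<in> A \<union> B \<Longrightarrow> g dvd i"
    if "admissible g A B S" for g A B S i
    using that unfolding admissible_def by blast+
  have Y1: "1 \<le> Y" using Y by simp
  define u v w where "u = exponent_profile Y a" and "v = exponent_profile Y b" and "w = exponent_profile Y c"
  have prfs: "profile u" "profile v" "profile w"
    unfolding u_def v_def w_def using profile_exponent_profile[OF Y(1)] D(1-3,6-8) by blast+
  have tot: "(\<Sum>i\<in>{1..6}. u i) + (\<Sum>i\<in>{1..6}. v i) + (\<Sum>i\<in>{1..6}. w i) \<le> lam"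
  proof -
    have "(\<Sum>i\<in>{1..6}. u i) + (\<Sum>i\<in>{1..6}. v i) + (\<Sum>i\<in>{1..6}. w i)
        = log Y (real (rad a)) + log Y (real (rad b)) + log Y (real (rad c))"
      unfolding u_def v_def w_def using D(1-3) Y(1) by (simp only: sum_exponent_profile)
    also have "\<dots> = log Y (real (rad a) * real (rad b) * real (rad c))"
      using Y(1) by (simp add: log_mult)
    also have "\<dots> \<le> log Y (Y powr lam)" using D(14) Y(1) by (subst log_le_cancel_iff) auto
    also have "\<dots> = lam" using Y by simp
    finally show ?thesis .
  qed
  have log4: "log Y 4 = 2 * log Y 2" using log_nat_power[of 2 Y 2] by simp
  have logc: "1 - log Y (real c) \<le> \<eta>" and logb: "1 - log Y (real b) \<le> 2 * \<eta>"
  proof -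
    have "log Y (Y / 2) \<le> log Y (real c)" using D(3,9) Y(1) by simp
    then show "1 - log Y (real c) \<le> \<eta>" using Y by (simp add: log_divide)
    have "log Y (Y / 4) \<le> log Y (real b)" using D(2,10) Y(1) by simp
    then show "1 - log Y (real b) \<le> 2 * \<eta>" using Y log4 by (simp add: log_divide)
  qed
  have mono: "2 * C ^ 18 * C' * Y powr (e + 120 * \<eta>) \<le> 2 * C ^ 18 * C' * Y powr (\<theta> + 120 * \<eta>)"
    if "e \<le> \<theta>" for e
    using that Y C by (intro mult_left_mono powr_mono) auto
  have one: "1 \<le> Y powr e" if "0 \<le> e" for e using that Y by (simp add: ge_one_powr_ge_zero)
  from no[of u v w] consider
    (c) "\<not> exceeds \<theta> u v w" | (a) "\<not> exceeds \<theta> v w u" | (b) "\<not> exceeds \<theta> u w v"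
    using prfs tot unfolding all_exceed_def by blast
  then show ?thesis
  proof cases
    case c
    then obtain g A B S where adm: "admissible g A B S"
      and le: "lattice_exponent g A B S u v w (part_size w) \<le> \<theta>" by (auto simp: exceeds_def not_less)
    have "real (card F) \<le> 2 * C ^ 18 * C' * Y powr (lattice_exponent g A B S u v w (part_size w) + 120 * \<eta>)"
    proof (rule card_fibre_le[OF \<eta> _ C count roots F(1), where U = fa and V = fb and W = fc and \<sigma> = 1 and \<tau> = 1])
      show "g dvd i" if "i \<in> A \<union> B" for i using admD(5)[OF adm that] .
      show "close_to \<eta> Y u (fa s) \<and> close_to \<eta> Y v (fb s) \<and> close_to \<eta> Y w (fc s)"
        if "s \<in> F" for s
        using cl[OF that] unfolding ft u_def v_def w_def by simp
      show "coprime (fa s) (fb s) \<and> coprime (fa s) (fc s) \<and> coprime (fb s) (fc s)" if "s \<in> F" for s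
        using cop[OF that] coprime_commute by blast
      show "int (fc s) dvd int (fa s) + 1 * int (fb s)" if "s \<in> F" for s
        using sum[OF that] by simp
      show "1 \<le> Y powr (20 * \<eta> - (\<Sum>i\<in>S. part_size w i)) * real (block S (fc s))" if s: "s \<in> F" for s
      proof -
        have "S \<subseteq> {1..6}" using admD(4)[OF adm] .
        \<comment> \<open>As \<open>c\<close> has nearly full size, \<open>\<tau> = 1\<close>
          already satisfies the hypothesis of \<open>thinness_le_block\<close>.\<close>
        moreover have "1 \<le> Y powr (14 * \<eta> - (1 - log Y (real c)))" by (rule one) (use logc \<eta> in linarith)
        ultimately show ?thesis
          unfolding w_def using nr(2)[of fc s] s by (intro thinness_le_block[OF Y(1) _ \<eta> D(3,8)]) (simp_all add: ft)
      qed
    qed (rule Y1 inj_ab inj_ac inj_bc admD(1-4)[OF adm] | simp)+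
    then show ?thesis using mono[OF le] by linarith
  next
    case b
    then obtain g A B S where adm: "admissible g A B S"
      and le: "lattice_exponent g A B S u w v (part_size v) \<le> \<theta>" by (auto simp: exceeds_def not_less)
    have "real (card F) \<le> 2 * C ^ 18 * C' * Y powr (lattice_exponent g A B S u w v (part_size v) + 120 * \<eta>)"
    proof (rule card_fibre_le[OF \<eta> _ C count roots F(1), where U = fa and V = fc and W = fb and \<sigma> = "-1" and \<tau> = 1])
      show "g dvd i" if "i \<in> A \<union> B" for i using admD(5)[OF adm that] .
      show "close_to \<eta> Y u (fa s) \<and> close_to \<eta> Y w (fc s) \<and> close_to \<eta> Y v (fb s)"
        if "s \<in> F" for s
        using cl[OF that] unfolding ft u_def v_def w_def by simp
      show "coprime (fa s) (fc s) \<and> coprime (fa s) (fb s) \<and> coprime (fc s) (fb s)" if "s \<in> F" for s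
        using cop[OF that] coprime_commute by blast
      show "int (fb s) dvd int (fa s) + -1 * int (fc s)" if "s \<in> F" for s
        using sum[OF that] by simp
      show "1 \<le> Y powr (20 * \<eta> - (\<Sum>i\<in>S. part_size v i)) * real (block S (fb s))" if s: "s \<in> F" for s
      proof -
        have "S \<subseteq> {1..6}" using admD(4)[OF adm] .
        moreover have "1 \<le> Y powr (14 * \<eta> - (1 - log Y (real b)))" by (rule one) (use logb \<eta> in linarith)
        ultimately show ?thesis
          unfolding v_def using nr(2)[of fb s] s by (intro thinness_le_block[OF Y(1) _ \<eta> D(2,7)]) (simp_all add: ft)
      qed
    qed (rule Y1 inj_ab inj_ac inj_bc admD(1-4)[OF adm] | simp)+
    then show ?thesis using mono[OF le] by linarith
  next
    case a
    then obtain g A B S where adm: "admissible g A B S"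
      and le: "lattice_exponent g A B S v w u (part_size u) \<le> \<theta>" by (auto simp: exceeds_def not_less)
    \<comment> \<open>An upper bound for a / b throughout the box: \<open>6 * \<eta>\<close> allows
      for the variation of a and \<open>2 * \<eta>\<close> for b being as small as Y / 4.\<close>
    define \<tau> where "\<tau> = Y powr (log Y (real a) - 1 + 8 * \<eta>)"
    have "real (card F) \<le> 2 * C ^ 18 * C' * Y powr (lattice_exponent g A B S v w u (part_size u) + 120 * \<eta>)"
    proof (rule card_fibre_le[OF \<eta> _ C count roots F(1), where U = fb and V = fc and W = fa and \<sigma> = "-1" and \<tau> = \<tau>])
      show "g dvd i" if "i \<in> A \<union> B" for i using admD(5)[OF adm that] .
      show "close_to \<eta> Y v (fb s) \<and> close_to \<eta> Y w (fc s) \<and> close_to \<eta> Y u (fa s)"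
        if "s \<in> F" for s
        using cl[OF that] unfolding ft u_def v_def w_def by simp
      show "coprime (fb s) (fc s) \<and> coprime (fb s) (fa s) \<and> coprime (fc s) (fa s)" if "s \<in> F" for s
        using cop[OF that] coprime_commute by blast
      show "int (fa s) dvd int (fb s) + -1 * int (fc s)" if "s \<in> F" for s
        using sum[OF that] by simp
      show "\<tau> \<le> Y powr (20 * \<eta> - (\<Sum>i\<in>S. part_size u i)) * real (block S (fa s))" if s: "s \<in> F" for s
      proof -
        have "S \<subseteq> {1..6}" using admD(4)[OF adm] .
        moreover have "\<tau> \<le> Y powr (14 * \<eta> - (1 - log Y (real a)))"
          unfolding \<tau>_def using Y \<eta> by (intro powr_mono) auto
        ultimately show ?thesis
          unfolding u_def using nr(2)[of fa s] s by (intro thinness_le_block[OF Y(1) _ \<eta> D(1,6)]) (simp_all add: ft)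
      qed
      show "\<tau> = 1 \<or> (\<forall>s\<in>F. fb s \<le> fc s \<and> real (fc s) \<le> (1 + \<tau>) * real (fb s))"
      proof (intro disjI2 ballI conjI)
        fix s assume s: "s \<in> F"
        note Ds = dyadic_triplesD[OF DF[OF s]]
        show "fb s \<le> fc s" using Ds(5) by simp
        \<comment> \<open>The full block is the number itself, so closeness of the six parts yields
          closeness of the first entries.\<close>
        have "log Y (real (block {1..6} (fa s))) \<le> log Y (real (block {1..6} a)) + 6 * \<eta>"
        proof -
          have "\<bar>log Y (real (block {1..6} (fa s))) - log Y (real (block {1..6} a))\<bar> \<le> 6 * \<eta>"
            by (rule log_block_diff[OF Y(1) _ \<eta>]) (use nr(2)[of fa s] s in \<open>simp_all add: ft\<close>)
          then show ?thesis by linarith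
        qed
        then have la: "log Y (real (fa s)) \<le> log Y (real a) + 6 * \<eta>"
          by (simp only: block_all[OF Ds(1)] block_all[OF D(1)])
        have "log Y (Y / 4) \<le> log Y (real (fb s))" using Ds(2,10) Y(1) by simp
        then have lb: "1 - 2 * \<eta> \<le> log Y (real (fb s))" using Y log4 by (simp add: log_divide)
        have "real (fa s) = Y powr log Y (real (fa s))" using Ds(1) Y(1) by simp
        also have "\<dots> \<le> Y powr ((log Y (real a) - 1 + 8 * \<eta>) + log Y (real (fb s)))"
          using la lb Y by (intro powr_mono) auto
        also have "\<dots> = \<tau> * real (fb s)" using Ds(2) Y(1) by (simp add: powr_add \<tau>_def)
        finally show "real (fc s) \<le> (1 + \<tau>) * real (fb s)" using Ds(5) by (simp add: algebra_simps)
      qed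
    qed (rule Y1 inj_ab inj_ac inj_bc admD(1-4)[OF adm] | simp add: \<tau>_def)+
    then show ?thesis using mono[OF le] by linarith
  qed
qed


section \<open>From boxes to dyadic ranges and to all triples\<close>

lemma finite_dyadic_triples: "finite (dyadic_triples lam Y)"
proof (rule finite_subset)
  show "dyadic_triples lam Y \<subseteq> {..nat \<lfloor>Y\<rfloor>} \<times> {..nat \<lfloor>Y\<rfloor>} \<times> {..nat \<lfloor>Y\<rfloor>}"
    using dyadic_triplesD(6-8) by (fastforce simp: le_nat_floor)
qed auto

lemma abs_diff_le_of_floor_eq:
  fixes x y \<eta> :: real
  assumes "0 < \<eta>" "\<lfloor>x / \<eta>\<rfloor> = \<lfloor>y / \<eta>\<rfloor>"
  shows "\<bar>x - y\<bar> \<le> \<eta>"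
proof -
  have "\<bar>x / \<eta> - y / \<eta>\<bar> \<le> 1" using assms(2) by linarith
  then have "\<bar>x - y\<bar> / \<eta> \<le> 1" using assms(1) by (simp add: abs_divide flip: diff_divide_distrib)
  then show ?thesis using assms(1) by simp
qed

text \<open>All logarithms to base \<open>Y\<close> lie between 0 and 1, so cutting them at steps of
  \<open>\<eta>\<close> produces a number of boxes that is bounded independently of
  \<open>Y\<close>.\<close>

lemma card_dyadic_triples_le:
  assumes no: "\<And>u v w. \<not> all_exceed \<theta> lam u v w" and \<theta>: "0 \<le> \<theta>" and \<epsilon>: "0 < \<epsilon>"
  shows "\<exists>C\<ge>0. \<forall>Y\<ge>1. real (card (dyadic_triples lam Y)) \<le> C * Y powr (\<theta> + \<epsilon>)"
proof -
  \<comment> \<open>Chosen so that the accumulated loss \<open>120 * \<eta>\<close> is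
    \<open>\<epsilon>\<close>.\<close>
  define \<eta> where "\<eta> = \<epsilon> / 120"
  have \<eta>: "0 < \<eta>" using \<epsilon> by (simp add: \<eta>_def)
  obtain C where C: "1 \<le> C" and count: "\<And>Y R::real. 1 \<le> Y \<Longrightarrow> 0 \<le> R \<Longrightarrow>
      real (card {s::nat. real s \<le> Y \<and> 0 < s \<and> real (rad s) \<le> R}) \<le> C * R * Y powr \<eta>"
    using card_small_rad_le[OF \<eta>] by blast
  obtain C' where C': "1 \<le> C'" and roots: "\<And>P::nat set. finite P \<Longrightarrow> (\<forall>p\<in>P. prime p) \<Longrightarrow>
      125 ^ card P \<le> C' * real (\<Prod>P) powr \<eta>"
    using power_card_primes_le[of 125 \<eta>] \<eta> by auto
  define Z where "Z = {1..6::nat} \<rightarrow>\<^sub>E {0..\<lfloor>1 / \<eta>\<rfloor>} \<times> {0..\<lfloor>1 / \<eta>\<rfloor>}"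
  have finZ: "finite (Z \<times> Z \<times> Z)" unfolding Z_def by (intro finite_cartesian_product finite_PiE) auto
  define N where "N = card (Z \<times> Z \<times> Z)"
  \<comment> \<open>From \<open>Y0\<close> on, \<open>log Y 2 \<le> \<eta>\<close> holds, so bounded
    factors count as losses of order \<open>\<eta>\<close>. For smaller \<open>Y\<close> there are
    at most \<open>M\<close> triples in any case.\<close>
  define Y0 where "Y0 = 2 powr (1 / \<eta>)"
  define M where "M = card ({..nat \<lfloor>Y0\<rfloor>} \<times> {..nat \<lfloor>Y0\<rfloor>} \<times> {..nat \<lfloor>Y0\<rfloor>})"
  define D where "D = real N * (2 * C ^ 18 * C') + real M"
  have "real (card (dyadic_triples lam Y)) \<le> D * Y powr (\<theta> + \<epsilon>)" if Y: "1 \<le> Y" for Y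
  proof (cases "Y0 \<le> Y")
    case False
    have "dyadic_triples lam Y \<subseteq> {..nat \<lfloor>Y0\<rfloor>} \<times> {..nat \<lfloor>Y0\<rfloor>} \<times> {..nat \<lfloor>Y0\<rfloor>}"
      using dyadic_triplesD(6-8)[of _ _ _ lam Y] False by (fastforce simp: le_nat_floor)
    then have "card (dyadic_triples lam Y) \<le> M" unfolding M_def by (intro card_mono) auto
    then have "real (card (dyadic_triples lam Y)) \<le> real M * 1" by simp
    also have "\<dots> \<le> D * Y powr (\<theta> + \<epsilon>)"
      using Y \<theta> \<epsilon> C C' unfolding D_def by (intro mult_mono ge_one_powr_ge_zero) auto
    finally show ?thesis .
  next
    case True
    have "1 < Y0" unfolding Y0_def using \<eta> by simp
    then have Y1: "1 < Y" using True by simp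
    have "log Y (Y0 powr \<eta>) \<le> log Y (Y powr \<eta>)"
      using True Y1 \<open>1 < Y0\<close> \<eta> by (subst log_le_cancel_iff) (auto intro: powr_mono2)
    then have log2: "log Y 2 \<le> \<eta>" using \<eta> Y1 by (simp add: Y0_def powr_powr)
    \<comment> \<open>Radicals locate a number in the sense of \<open>close_to\<close>; the sizes of
      the parts are recorded as well to control the modulus and the thinness.\<close>
    define cell where "cell = (\<lambda>n. restrict (\<lambda>i. (\<lfloor>log Y (real (rad (part i n))) / \<eta>\<rfloor>, \<lfloor>log Y (real (part i n)) / \<eta>\<rfloor>)) {1..6})"
    define key where "key = (\<lambda>s. (cell (fst s), cell (fst (snd s)), cell (snd (snd s))))"
    have cell: "cell n \<in> Z" if n: "0 < n" "real n \<le> Y" for n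
    proof -
      have "\<lfloor>log Y (real k) / \<eta>\<rfloor> \<in> {0..\<lfloor>1 / \<eta>\<rfloor>}" if k: "0 < k" "k \<le> n" for k
        using log_nat_bounds[OF Y1 k(1)] k n \<eta> by (auto intro!: floor_mono divide_right_mono)
      moreover have "part i n \<le> n" "rad (part i n) \<le> n" if "i \<in> {1..6}" for i
        using part_le[OF n(1) that] rad_le[of "part i n"] by auto
      ultimately show ?thesis unfolding Z_def cell_def by (auto simp: rad_pos)
    qed
    have "key ` dyadic_triples lam Y \<subseteq> Z \<times> Z \<times> Z"
    proof
      fix k assume "k \<in> key ` dyadic_triples lam Y"
      then obtain a b c where abc: "(a, b, c) \<in> dyadic_triples lam Y" "k = key (a, b, c)" by auto
      show "k \<in> Z \<times> Z \<times> Z"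
        using cell[OF dyadic_triplesD(1,6)[OF abc(1)]] cell[OF dyadic_triplesD(2,7)[OF abc(1)]] cell[OF dyadic_triplesD(3,8)[OF abc(1)]]
        by (simp add: abc(2) key_def)
    qed
    then have "dyadic_triples lam Y = (\<Union>k\<in>Z \<times> Z \<times> Z. {s\<in>dyadic_triples lam Y. key s = k})" by blast
    then have "card (dyadic_triples lam Y) \<le> (\<Sum>k\<in>Z \<times> Z \<times> Z. card {s\<in>dyadic_triples lam Y. key s = k})"
      using card_UN_le[OF finZ, of "\<lambda>k. {s\<in>dyadic_triples lam Y. key s = k}"] by simp
    then have "real (card (dyadic_triples lam Y)) \<le> (\<Sum>k\<in>Z \<times> Z \<times> Z. real (card {s\<in>dyadic_triples lam Y. key s = k}))"
      by (simp flip: of_nat_sum)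
    also have "\<dots> \<le> real (card (Z \<times> Z \<times> Z)) * (2 * C ^ 18 * C' * Y powr (\<theta> + 120 * \<eta>))"
    proof (rule sum_bounded_above)
      fix k
      show "real (card {s\<in>dyadic_triples lam Y. key s = k}) \<le> 2 * C ^ 18 * C' * Y powr (\<theta> + 120 * \<eta>)"
      proof (rule card_dyadic_fibre_le[OF \<eta> Y1 log2 C C' count roots no])
        fix f :: "nat \<times> nat \<times> nat \<Rightarrow> nat" and s t i
        assume f: "f \<in> {fst, fst \<circ> snd, snd \<circ> snd}" and st: "s \<in> {s\<in>dyadic_triples lam Y. key s = k}" "t \<in> {s\<in>dyadic_triples lam Y. key s = k}"
          and i: "i \<in> {1..6::nat}"
        have "key s = key t" using st by simp
        then have "cell (f s) = cell (f t)" using f by (auto simp: key_def)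
        then have "cell (f s) i = cell (f t) i" by simp
        then have "\<lfloor>log Y (real (rad (part i (f s)))) / \<eta>\<rfloor> = \<lfloor>log Y (real (rad (part i (f t)))) / \<eta>\<rfloor>"
          "\<lfloor>log Y (real (part i (f s))) / \<eta>\<rfloor> = \<lfloor>log Y (real (part i (f t))) / \<eta>\<rfloor>"
          using i by (simp_all add: cell_def)
        then show "\<bar>log Y (real (rad (part i (f s)))) - log Y (real (rad (part i (f t))))\<bar> \<le> \<eta> \<and>
            \<bar>log Y (real (part i (f s))) - log Y (real (part i (f t)))\<bar> \<le> \<eta>"
          using abs_diff_le_of_floor_eq[OF \<eta>] by blast
      qed (auto simp: finite_dyadic_triples)
    qed
    also have "\<dots> = real N * (2 * C ^ 18 * C') * Y powr (\<theta> + \<epsilon>)" by (simp add: N_def \<eta>_def)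
    also have "\<dots> \<le> D * Y powr (\<theta> + \<epsilon>)" unfolding D_def by (intro mult_right_mono) auto
    finally show ?thesis .
  qed
  moreover have "0 \<le> D" unfolding D_def using C C' by simp
  ultimately show ?thesis by blast
qed

text \<open>Triples with c above X / 2 become dyadic ones after sorting a and b, whence the factor
  2; comparing the radical with X instead of c only weakens the condition, as \<open>lam\<close> is
  positive.\<close>

lemma abc_count_halving:
  assumes "0 < lam"
  shows "abc_count lam X \<le> abc_count lam (X / 2) + 2 * card (dyadic_triples lam X)"
proof -
  define T where "T = (\<lambda>X. {(a::nat, b::nat, c::nat).
             0 < a \<and> 0 < b \<and> 0 < c \<and> a + b = c \<and> real c \<le> X \<and>
             gcd a (gcd b c) = 1 \<and> real (rad (a * b * c)) < real c powr lam})"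
  define flip where "flip = (\<lambda>(a::nat, b::nat, c::nat). (b, a, c))"
  have fin: "finite (T X)" for X
  proof (rule finite_subset)
    show "T X \<subseteq> {..nat \<lfloor>X\<rfloor>} \<times> {..nat \<lfloor>X\<rfloor>} \<times> {..nat \<lfloor>X\<rfloor>}" by (auto simp: T_def le_nat_floor)
  qed auto
  have "T X \<subseteq> T (X / 2) \<union> (dyadic_triples lam X \<union> flip ` dyadic_triples lam X)"
  proof
    fix s assume s: "s \<in> T X"
    obtain a b c where abc: "s = (a, b, c)" by (cases s)
    have *: "0 < a" "0 < b" "0 < c" "a + b = c" "real c \<le> X" "gcd a (gcd b c) = 1"
      "real (rad (a * b * c)) < real c powr lam" using s by (auto simp: T_def abc)
    have "gcd a (gcd b c) = gcd a b"
    proof -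
      have "gcd b c = gcd b (b + a)" using *(4) by (simp only: add.commute)
      then show ?thesis by (simp flip: gcd.assoc)
    qed
    then have "gcd a b = 1" using *(6) by (simp only:)
    then have cop: "coprime a b" "coprime b a"
      using gcd_eq_1_imp_coprime[of a b] gcd_eq_1_imp_coprime[of b a] by (simp_all only: gcd.commute[of b a])
    have "real c powr lam \<le> X powr lam" using * assms by (intro powr_mono2) auto
    then have rad: "real (rad (a * b * c)) < X powr lam" using *(7) by linarith
    show "s \<in> T (X / 2) \<union> (dyadic_triples lam X \<union> flip ` dyadic_triples lam X)"
    proof (cases "real c \<le> X / 2")
      case True
      then show ?thesis using * by (simp add: T_def abc)
    next
      case large: False
      show ?thesis
      proof (cases "a \<le> b")
        case True
        then have "(a, b, c) \<in> dyadic_triples lam X"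
          unfolding dyadic_triples_def using * large cop rad by simp
        then show ?thesis by (simp add: abc)
      next
        case False
        then have "(b, a, c) \<in> dyadic_triples lam X"
          unfolding dyadic_triples_def using * large cop rad by (simp add: mult.commute[of b a] add.commute[of b a])
        then have "flip (b, a, c) \<in> flip ` dyadic_triples lam X" by (rule imageI)
        then show ?thesis by (simp add: abc flip_def)
      qed
    qed
  qed
  then have "card (T X) \<le> card (T (X / 2) \<union> (dyadic_triples lam X \<union> flip ` dyadic_triples lam X))"
    using fin finite_dyadic_triples by (intro card_mono) auto
  also have "\<dots> \<le> card (T (X / 2)) + card (dyadic_triples lam X \<union> flip ` dyadic_triples lam X)" by (rule card_Un_le)
  also have "card (dyadic_triples lam X \<union> flip ` dyadic_triples lam X) \<le> card (dyadic_triples lam X) + card (flip ` dyadic_triples lam X)"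
    by (rule card_Un_le)
  also have "card (flip ` dyadic_triples lam X) \<le> card (dyadic_triples lam X)" by (rule card_image_le[OF finite_dyadic_triples])
  finally show ?thesis by (simp add: abc_count_def T_def)
qed

lemma abc_count_eq_0: "X < 1 \<Longrightarrow> abc_count lam X = 0"
proof -
  assume "X < 1"
  then have "{(a::nat, b::nat, c::nat). 0 < a \<and> 0 < b \<and> 0 < c \<and> a + b = c \<and> real c \<le> X \<and>
             gcd a (gcd b c) = 1 \<and> real (rad (a * b * c)) < real c powr lam} = {}" by auto
  then show ?thesis unfolding abc_count_def by (simp only: card.empty)
qed

lemma abc_count_le:
  assumes no: "\<And>u v w. \<not> all_exceed \<theta> lam u v w" and lam: "0 < lam" and \<theta>: "0 \<le> \<theta>" and \<epsilon>: "0 < \<epsilon>"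
  shows "\<exists>C. \<forall>X\<ge>1. real (abc_count lam X) \<le> C * X powr (\<theta> + \<epsilon>)"
proof -
  define p where "p = \<theta> + \<epsilon>"
  have p: "0 < p" using \<theta> \<epsilon> by (simp add: p_def)
  obtain C where C: "0 \<le> C" and tr: "\<And>Y. 1 \<le> Y \<Longrightarrow> real (card (dyadic_triples lam Y)) \<le> C * Y powr p"
    using card_dyadic_triples_le[OF no \<theta> \<epsilon>] unfolding p_def by blast
  \<comment> \<open>The solution of \<open>D = D * 2 powr - p + 2 * C\<close>, so that the bound
    reproduces itself when \<open>X\<close> is halved; the induction ends at \<open>X < 1\<close>,
    where no triples exist.\<close>
  define D where "D = 2 * C / (1 - 2 powr - p)"
  have t1: "2 powr - p < (1::real)" using p by (simp add: powr_less_one)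
  have D0: "0 \<le> D" unfolding D_def using C t1 by simp
  have "D * (1 - 2 powr - p) = 2 * C" unfolding D_def using t1 p by simp
  then have D: "D * 2 powr - p + 2 * C = D" by (simp add: right_diff_distrib)
  have "real (abc_count lam X) \<le> D * X powr p" if "X < 2 ^ k" for k X
    using that
  proof (induction k arbitrary: X)
    case 0
    then show ?case using D0 by (simp add: abc_count_eq_0)
  next
    case (Suc k)
    show ?case
    proof (cases "X < 1")
      case True
      then show ?thesis using D0 by (simp add: abc_count_eq_0)
    next
      case False
      have "abc_count lam X \<le> abc_count lam (X / 2) + 2 * card (dyadic_triples lam X)"
        by (rule abc_count_halving[OF lam])
      then have "real (abc_count lam X) \<le> real (abc_count lam (X / 2)) + 2 * real (card (dyadic_triples lam X))"
        by linarith
      also have "real (abc_count lam (X / 2)) \<le> D * (X / 2) powr p" using Suc.prems by (intro Suc.IH) simp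
      also have "(X / 2) powr p = X powr p * 2 powr - p"
        using False by (simp add: powr_divide powr_minus_divide)
      also have "real (card (dyadic_triples lam X)) \<le> C * X powr p" using False by (intro tr) simp
      finally have "real (abc_count lam X) \<le> (D * 2 powr - p + 2 * C) * X powr p"
        by (simp add: algebra_simps)
      then show ?thesis by (simp only: D)
    qed
  qed
  moreover have "\<exists>k. X < 2 ^ k" for X :: real by (rule real_arch_pow) simp
  ultimately show ?thesis unfolding p_def by blast
qed

lemma not_all_exceed_below_two:
  assumes "0 < lam" "lam < 2"
  shows "\<not> all_exceed ((23 * lam + 3) / 40) lam u v w"
proof
  assume "all_exceed ((23 * lam + 3) / 40) lam u v w"
  from not_all_exceed[OF this] not_all_exceed_small[OF this] show False using assms by linarith
qed

theorem theorem1p1: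
  shows "(\<forall>lam::real. 0 < lam \<and> lam < 2 \<longrightarrow> (\<forall>\<epsilon>::real. \<epsilon> > 0 \<longrightarrow>
            (\<exists>C::real. \<forall>X::real. X \<ge> 1 \<longrightarrow>
               real (abc_count lam X) \<le> C * X powr ((23 * lam + 3) / 40 + \<epsilon>))))
       \<and> (\<forall>\<epsilon>::real. \<epsilon> > 0 \<longrightarrow>
            (\<exists>C::real. \<forall>X::real. X \<ge> 1 \<longrightarrow>
               real (abc_count 1 X) \<le> C * X powr (65 / 100 + \<epsilon>)))
       \<and> (\<forall>lam::real. 9 / 11 < lam \<and> lam < 3 \<longrightarrow>
            (\<lambda>X::real. real (abc_count lam X)) \<in> o[at_top](\<lambda>X. X powr (2 * lam / 3)))"
proof (intro conjI allI impI)
  fix lam \<epsilon> :: real assume "0 < lam \<and> lam < 2" "0 < \<epsilon>"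
  then show "\<exists>C. \<forall>X\<ge>1. real (abc_count lam X) \<le> C * X powr ((23 * lam + 3) / 40 + \<epsilon>)"
    using not_all_exceed_below_two[of lam] by (intro abc_count_le) auto
next
  fix \<epsilon> :: real assume "0 < \<epsilon>"
  then have "\<exists>C. \<forall>X\<ge>1. real (abc_count 1 X) \<le> C * X powr ((23 * 1 + 3) / 40 + \<epsilon>)"
    using not_all_exceed_below_two[of 1] by (intro abc_count_le) auto
  then show "\<exists>C. \<forall>X\<ge>1. real (abc_count 1 X) \<le> C * X powr (65 / 100 + \<epsilon>)" by simp
next
  fix lam :: real assume lam: "9 / 11 < lam \<and> lam < 3"
  \<comment> \<open>Both choices lie below 2 lam / 3: the first because lam > 9 / 11; for lam at
    least 2, 6 / 5 < 4 / 3, and lam - 1 < 2 lam / 3 because lam < 3. Half of the remaining gap is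
    then spent on \<open>\<epsilon>\<close>.\<close>
  define \<theta> where "\<theta> = (if lam < 2 then (23 * lam + 3) / 40 else max (6 / 5) (lam - 1))"
  define \<epsilon> where "\<epsilon> = (2 * lam / 3 - \<theta>) / 2"
  have no: "\<not> all_exceed \<theta> lam u v w" for u v w
  proof (cases "lam < 2")
    case True
    then show ?thesis using not_all_exceed_below_two[of lam] lam by (simp add: \<theta>_def)
  next
    case False
    then have "6 / 5 \<le> \<theta>" "lam - 1 \<le> \<theta>" by (auto simp: \<theta>_def)
    then show ?thesis using not_all_exceed_large by blast
  qed
  have less: "\<theta> < 2 * lam / 3" and \<theta>: "0 \<le> \<theta>" using lam by (auto simp: \<theta>_def max_def)
  then have "0 < \<epsilon>" by (simp add: \<epsilon>_def)
  then obtain C where C: "\<And>X. 1 \<le> X \<Longrightarrow> real (abc_count lam X) \<le> C * X powr (\<theta> + \<epsilon>)"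
    using abc_count_le[OF no _ \<theta>, of \<epsilon>] lam by auto
  have "(\<lambda>X. real (abc_count lam X)) \<in> O[at_top](\<lambda>X. X powr (\<theta> + \<epsilon>))"
    using C by (intro bigoI[of _ C] eventually_mono[OF eventually_ge_at_top[of 1]]) auto
  also have "(\<lambda>X::real. X powr (\<theta> + \<epsilon>)) \<in> o[at_top](\<lambda>X. X powr (2 * lam / 3))"
    using less by (subst powr_smallo_iff) (auto simp: filterlim_ident \<epsilon>_def field_simps)
  finally show "(\<lambda>X. real (abc_count lam X)) \<in> o[at_top](\<lambda>X. X powr (2 * lam / 3))" .
qed

end
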